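(* Let $n\ge 2$. Let $\mathfrak p=(p_1,p_2,p_3)$ and $\mathfrak q=(q_1,q_2,q_3)$ be triples of pairwise distinct points in $\overline{\mathbf H_{\mathbb H}^n}$. Then there exists an isometry $h\in \mathrm{Sp}(n,1)$ such that $h(p_1)=q_1$, $h(p_2)=q_2$, $h(p_3)=q_3$ if and only if one of the following conditions holds: (i) $\mathfrak p,\mathfrak q\in \partial\mathbf H_{\mathbb H}^n\times\partial\mathbf H_{\mathbb H}^n\times\partial\mathbf H_{\mathbb H}^n$ and $\mathbb A_{\mathbb H}(\mathfrak p)=\mathbb A_{\mathbb H}(\mathfrak q)$. (ii) $\mathfrak p,\mathfrak q\in \partial\mathbf H_{\mathbb H}^n\times\partial\mathbf H_{\mathbb H}^n\times\mathbf H_{\mathbb H}^n$, $\mathbb A_{\mathbb H}(\mathfrak p)=\mathbb A_{\mathbb H}(\mathfrak q)$ and $\rho(L_{p_1p_2},p_3)=\rho(L_{q_1q_2},q_3)$. (iii) $\mathfrak p,\mathfrak q\in \partial\mathbf H_{\mathbb H}^n\times\mathbf H_{\mathbb H}^n\times\mathbf H_{\mathbb H}^n$, $\rho(L_{p_1p_2},p_3)=\rho(L_{q_1q_2},q_3)$, $\rho(L_{p_1p_3},p_2)=\rho(L_{q_1q_3},q_2)$ and $\rho(p_2,p_3)=\rho(q_2,q_3)$. (iv) $\mathfrak p,\mathfrak q\in \mathbf H_{\mathbb H}^n\times\mathbf H_{\mathbb H}^n\times\mathbf H_{\mathbb H}^n$, $\mathbb A_{\mathbb H}(\mathfrak p)=\mathbb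 A_{\mathbb H}(\mathfrak q)$, $\rho(p_1,p_2)=\rho(q_1,q_2)$, $\rho(p_1,p_3)=\rho(q_1,q_3)$ and $\rho(p_2,p_3)=\rho(q_2,q_3)$.
   Context: $\mathbb H$ denotes the quaternions, with conjugate $\bar a$, modulus $|a|$ and real part $\Re(a)$. $\mathbb H^{n,1}$ is the right quaternionic vector space of column vectors $\mathbb H^{n+1}$ with the Hermitian form $\langle \mathbf z,\mathbf w\rangle=\mathbf w^*J\mathbf z=\overline{w_1}z_{n+1}+\overline{w_2}z_2+\cdots+\overline{w_n}z_n+\overline{w_{n+1}}z_1$, where $J=\begin{pmatrix}0&0&1\\0&I_{n-1}&0\\1&0&0\end{pmatrix}$. Let $V_0=\{\mathbf z\neq 0:\langle\mathbf z,\mathbf z\rangle=0\}$, $V_-=\{\mathbf z:\langle\mathbf z,\mathbf z\rangle<0\}$, and let $\mathbb P$ be the right projection of $\mathbb H^{n,1}\setminus\{0\}$ onto quaternionic projective space (identifying $\mathbf z$ with $\mathbf z\lambda$, $\lambda\in\mathbb H\setminus\{0\}$). Then $\mathbf H_{\mathbb H}^n=\mathbb P(V_-)$, $\partial\mathbf H_{\mathbb H}^n=\mathbb P(V_0)$, $\overline{\mathbf H_{\mathbb H}^n}=\mathbf H_{\mathbb H}^n\cup\partial\mathbf H_{\mathbb H}^n$. A lift of a point $p$ is any vector $\mathbf p\in\mathbb P^{-1}(p)$. $\mathrm{Sp}(n,1)=\{g\in GL(n+1,\mathbb H): g^*Jg=J\}$ acts on $\overline{\mathbf H_{\mathbb H}^n}$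 by $g(\mathbb P\mathbf z)=\mathbb P(g\mathbf z)$. The Bergman metric $\rho$ on $\mathbf H_{\mathbb H}^n$ is given by $\cosh^2\frac{\rho(z,w)}{2}=\frac{\langle\mathbf z,\mathbf w\rangle\langle\mathbf w,\mathbf z\rangle}{\langle\mathbf z,\mathbf z\rangle\langle\mathbf w,\mathbf w\rangle}$ for lifts $\mathbf z,\mathbf w$ of $z,w$. For a triple $\mathfrak p=(p_1,p_2,p_3)$ of pairwise distinct points of $\overline{\mathbf H_{\mathbb H}^n}$ with lifts $\mathbf p_1,\mathbf p_2,\mathbf p_3$, put $\langle\mathbf p_1,\mathbf p_2,\mathbf p_3\rangle=\langle\mathbf p_2,\mathbf p_1\rangle\langle\mathbf p_3,\mathbf p_2\rangle\langle\mathbf p_1,\mathbf p_3\rangle$. The quaternionic Cartan angular invariant is $\mathbb A_{\mathbb H}(\mathfrak p)=\mathbb A_{\mathbb H}(p_1,p_2,p_3)=\arccos\frac{\Re(-\langle\mathbf p_1,\mathbf p_2,\mathbf p_3\rangle)}{|\langle\mathbf p_1,\mathbf p_2,\mathbf p_3\rangle|}\in[0,\pi/2]$ (independent of the lifts). For distinct $u,v\in\overline{\mathbf H_{\mathbb H}^n}$ with lifts $\mathbf u,\mathbf v$, the quaternionic line spanned by $u,v$ is $L_{uv}=\mathbb P(\{\mathbf u\lambda+\mathbf v\mu:\lambda,\mu\in\mathbb H\}\setminus\{0\})\cap\overline{\mathbf H_{\mathbb H}^n}$. For $z\in\mathbf H_{\mathbb H}^n$, $\rho(L_{uv},z)$ is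 the hyperbolic distance from $z$ to $L_{uv}$, i.e. the infimum of $\rho(x,z)$ over $x\in L_{uv}\cap\mathbf H_{\mathbb H}^n$.
   Formalization: Boundary points of p are assumed listed first (otherwise p = q with p1 interior, p2, p3 boundary is a counterexample), and when p1 is boundary and p2, p3 are interior, p3 is assumed not on the line L_{p1p2}, since (iii) does not imply congruence for collinear triples. *)

theory Defs
  imports "Jordan_Normal_Form.Matrix"
begin

section \<open>Quaternions\<close>

codatatype quat = Quat (qRe: real) (Im1: real) (Im2: real) (Im3: real)

lemma quat_eqI [intro?]:
  "qRe x = qRe y \<Longrightarrow> Im1 x = Im1 y \<Longrightarrow> Im2 x = Im2 y \<Longrightarrow> Im3 x = Im3 y \<Longrightarrow> x = y"
  by (rule quat.expand) simp

lemma quat_eq_iff: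
  "x = y \<longleftrightarrow> qRe x = qRe y \<and> Im1 x = Im1 y \<and> Im2 x = Im2 y \<and> Im3 x = Im3 y"
  by (auto intro: quat.expand)

instantiation quat :: ab_group_add
begin

primcorec zero_quat where
  "qRe 0 = 0" | "Im1 0 = 0" | "Im2 0 = 0" | "Im3 0 = 0"

primcorec plus_quat where
  "qRe (x + y) = qRe x + qRe y"
| "Im1 (x + y) = Im1 x + Im1 y"
| "Im2 (x + y) = Im2 x + Im2 y"
| "Im3 (x + y) = Im3 x + Im3 y"

primcorec uminus_quat where
  "qRe (- x) = - qRe x"
| "Im1 (- x) = - Im1 x"
| "Im2 (- x) = - Im2 x"
| "Im3 (- x) = - Im3 x"

primcorec minus_quat where
  "qRe (x - y) = qRe x - qRe y"
| "Im1 (x - y) = Im1 x - Im1 y"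
| "Im2 (x - y) = Im2 x - Im2 y"
| "Im3 (x - y) = Im3 x - Im3 y"

instance
  by standard (simp_all add: quat_eq_iff)

end

lemma quat_sq_sum_eq_0_iff:
  "(qRe x)\<^sup>2 + (Im1 x)\<^sup>2 + (Im2 x)\<^sup>2 + (Im3 x)\<^sup>2 = 0 \<longleftrightarrow> x = 0"
  by (simp add: quat_eq_iff add_nonneg_eq_0_iff)

instantiation quat :: division_ring
begin

primcorec one_quat where
  "qRe 1 = 1" | "Im1 1 = 0" | "Im2 1 = 0" | "Im3 1 = 0"

primcorec times_quat where
  "qRe (x * y) = qRe x * qRe y - Im1 x * Im1 y - Im2 x * Im2 y - Im3 x * Im3 y"
| "Im1 (x * y) = qRe x * Im1 y + Im1 x * qRe y + Im2 x * Im3 y - Im3 x * Im2 y"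
| "Im2 (x * y) = qRe x * Im2 y - Im1 x * Im3 y + Im2 x * qRe y + Im3 x * Im1 y"
| "Im3 (x * y) = qRe x * Im3 y + Im1 x * Im2 y - Im2 x * Im1 y + Im3 x * qRe y"

primcorec inverse_quat where
  "qRe (inverse x) = qRe x / ((qRe x)\<^sup>2 + (Im1 x)\<^sup>2 + (Im2 x)\<^sup>2 + (Im3 x)\<^sup>2)"
| "Im1 (inverse x) = - Im1 x / ((qRe x)\<^sup>2 + (Im1 x)\<^sup>2 + (Im2 x)\<^sup>2 + (Im3 x)\<^sup>2)"
| "Im2 (inverse x) = - Im2 x / ((qRe x)\<^sup>2 + (Im1 x)\<^sup>2 + (Im2 x)\<^sup>2 + (Im3 x)\<^sup>2)"
| "Im3 (inverse x) = - Im3 x / ((qRe x)\<^sup>2 + (Im1 x)\<^sup>2 + (Im2 x)\<^sup>2 + (Im3 x)\<^sup>2)"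

definition "x div y = x * inverse y" for x y :: quat

instance
proof
  fix x y z :: quat
  show "x * y * z = x * (y * z)"
    by (simp add: quat_eq_iff algebra_simps)
  show "(x + y) * z = x * z + y * z" "x * (y + z) = x * y + x * z"
    by (simp_all add: quat_eq_iff algebra_simps)
  show "1 * x = x" "x * 1 = x" "(0::quat) \<noteq> 1"
    by (simp_all add: quat_eq_iff)
  show "x div y = x * inverse y"
    by (rule divide_quat_def)
  show "inverse (0::quat) = 0"
    by (simp add: quat_eq_iff)
  assume "x \<noteq> 0"
  define d where "d = (qRe x)\<^sup>2 + (Im1 x)\<^sup>2 + (Im2 x)\<^sup>2 + (Im3 x)\<^sup>2"
  have d: "d \<noteq> 0"
    using \<open>x \<noteq> 0\<close> by (simp add: d_def quat_sq_sum_eq_0_iff)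
  have d': "qRe x * qRe x + Im1 x * Im1 x + Im2 x * Im2 x + Im3 x * Im3 x = d"
    by (simp add: d_def power2_eq_square)
  show "inverse x * x = 1" "x * inverse x = 1"
    using d d' by (simp_all add: quat_eq_iff flip: d_def) (simp_all add: field_simps)
qed

end

instantiation quat :: real_algebra_1
begin

primcorec scaleR_quat where
  "qRe (r *\<^sub>R x) = r * qRe x"
| "Im1 (r *\<^sub>R x) = r * Im1 x"
| "Im2 (r *\<^sub>R x) = r * Im2 x"
| "Im3 (r *\<^sub>R x) = r * Im3 x"

instance
  by standard (simp_all add: quat_eq_iff algebra_simps)

end

instantiation quat :: real_normed_div_algebra
begin

definition "norm x = sqrt ((qRe x)\<^sup>2 + (Im1 x)\<^sup>2 + (Im2 x)\<^sup>2 + (Im3 x)\<^sup>2)" for x :: quat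

definition "sgn x = x /\<^sub>R norm x" for x :: quat

definition "dist x y = norm (x - y)" for x y :: quat

definition uniformity_quat_def [code del]:
  "(uniformity :: (quat \<times> quat) filter) = (INF e\<in>{0 <..}. principal {(x, y). dist x y < e})"

definition open_quat_def [code del]:
  "open (U :: quat set) \<longleftrightarrow> (\<forall>x\<in>U. eventually (\<lambda>(x', y). x' = x \<longrightarrow> y \<in> U) uniformity)"

instance
proof
  fix r :: real and x y :: quat
  show "norm x = 0 \<longleftrightarrow> x = 0"
    by (simp add: norm_quat_def quat_sq_sum_eq_0_iff)
  show "norm (r *\<^sub>R x) = \<bar>r\<bar> * norm x"
    by (simp add: norm_quat_def power_mult_distrib real_sqrt_mult flip: distrib_left)
  show "norm (x * y) = norm x * norm y"
    by (simp add: norm_quat_def real_sqrt_mult [symmetric] power2_eq_square algebra_simps)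
  have *: "norm z = sqrt ((sqrt ((qRe z)\<^sup>2 + (Im1 z)\<^sup>2))\<^sup>2 + (sqrt ((Im2 z)\<^sup>2 + (Im3 z)\<^sup>2))\<^sup>2)"
    for z :: quat
    by (simp add: norm_quat_def add.assoc)
  have "norm (x + y) \<le> sqrt ((sqrt ((qRe x)\<^sup>2 + (Im1 x)\<^sup>2) + sqrt ((qRe y)\<^sup>2 + (Im1 y)\<^sup>2))\<^sup>2
      + (sqrt ((Im2 x)\<^sup>2 + (Im3 x)\<^sup>2) + sqrt ((Im2 y)\<^sup>2 + (Im3 y)\<^sup>2))\<^sup>2)"
    unfolding * plus_quat.sel
    by (intro real_sqrt_le_mono add_mono power_mono real_sqrt_sum_squares_triangle_ineq) auto
  also have "\<dots> \<le> norm x + norm y"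
    unfolding * by (rule real_sqrt_sum_squares_triangle_ineq)
  finally show "norm (x + y) \<le> norm x + norm y" .
qed (rule sgn_quat_def dist_quat_def open_quat_def uniformity_quat_def)+

end

primcorec qcnj :: "quat \<Rightarrow> quat" where
  "qRe (qcnj x) = qRe x"
| "Im1 (qcnj x) = - Im1 x"
| "Im2 (qcnj x) = - Im2 x"
| "Im3 (qcnj x) = - Im3 x"


section \<open>The Hermitian form and its isometry group\<close>

text \<open>
  Indices run over \<open>{0..n}\<close>, so \<open>z $ i\<close> is the coordinate \<open>z\<^sub>i\<^sub>+\<^sub>1\<close> of the column vector \<open>z\<close>.
\<close>

definition Jmat :: "nat \<Rightarrow> quat mat" where
  "Jmat n = mat (n + 1) (n + 1)
     (\<lambda>(i, j). if (i = 0 \<and> j = n) \<or> (i = n \<and> j = 0) \<or> (i = j \<and> 0 < i \<and> i < n) then 1 else 0)"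

definition adjoint_mat :: "quat mat \<Rightarrow> quat mat" where
  "adjoint_mat A = map_mat qcnj (transpose_mat A)"

definition herm :: "nat \<Rightarrow> quat vec \<Rightarrow> quat vec \<Rightarrow> quat" where
  "herm n z w = map_vec qcnj w \<bullet> (Jmat n *\<^sub>v z)"

definition Sp :: "nat \<Rightarrow> quat mat set" where
  "Sp n = {g \<in> carrier_mat (n + 1) (n + 1).
             invertible_mat g \<and> adjoint_mat g * Jmat n * g = Jmat n}"

lemma herm_eq_sum:
  assumes "z \<in> carrier_vec (n + 1)" "w \<in> carrier_vec (n + 1)" "n \<ge> 1"
  shows "herm n z w = qcnj (w $ 0) * z $ n + (\<Sum>i\<in>{1..<n}. qcnj (w $ i) * z $ i) + qcnj (w $ n) * z $ 0"
proof -
  have J: "(Jmat n *\<^sub>v z) $ i = z $ (if i = 0 then n else if i = n then 0 else i)"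
    if i: "i \<le> n" for i
  proof -
    let ?k = "if i = 0 then n else if i = n then 0 else i"
    have "(Jmat n *\<^sub>v z) $ i = (\<Sum>j\<in>{0..<n + 1}. (if j = ?k then 1 else 0) * z $ j)"
      using assms i by (auto simp: Jmat_def scalar_prod_def intro!: sum.cong)
    also have "\<dots> = (\<Sum>j\<in>{0..<n + 1}. if j = ?k then z $ j else 0)"
      by (intro sum.cong) auto
    also have "\<dots> = z $ ?k"
      using i by (subst sum.delta) auto
    finally show ?thesis .
  qed
  have split: "{0..<n + 1} = insert 0 (insert n {1..<n})"
    using assms(3) by auto
  have "herm n z w = (\<Sum>i\<in>{0..<n + 1}. qcnj (w $ i) * (Jmat n *\<^sub>v z) $ i)"
    using assms by (simp add: herm_def scalar_prod_def Jmat_def)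
  also have "\<dots> = (\<Sum>i\<in>{0..<n + 1}. qcnj (w $ i) * z $ (if i = 0 then n else if i = n then 0 else i))"
    by (intro sum.cong) (auto simp: J)
  also have "\<dots> = qcnj (w $ 0) * z $ n + (\<Sum>i\<in>{1..<n}. qcnj (w $ i) * z $ i) + qcnj (w $ n) * z $ 0"
  proof -
    have "(\<Sum>i\<in>{1..<n}. qcnj (w $ i) * z $ (if i = 0 then n else if i = n then 0 else i))
        = (\<Sum>i\<in>{1..<n}. qcnj (w $ i) * z $ i)"
      by (intro sum.cong) auto
    then show ?thesis
      unfolding split using assms(3) by (subst sum.insert) (auto simp: algebra_simps)
  qed
  finally show ?thesis .
qed

lemma qcnj_sum: "qcnj (sum f A) = (\<Sum>x\<in>A. qcnj (f x))"
  by (induction A rule: infinite_finite_induct) (simp_all add: quat_eq_iff)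

lemma qcnj_herm:
  assumes "z \<in> carrier_vec (n + 1)" "w \<in> carrier_vec (n + 1)" "n \<ge> 1"
  shows "qcnj (herm n z w) = herm n w z"
proof -
  have [simp]: "qcnj (x * y) = qcnj y * qcnj x" "qcnj (x + y) = qcnj x + qcnj y"
    "qcnj (qcnj x) = x" for x y
    by (simp_all add: quat_eq_iff algebra_simps)
  show ?thesis
    using assms by (simp add: herm_eq_sum qcnj_sum algebra_simps)
qed

lemma herm_self_real:
  assumes "z \<in> carrier_vec (n + 1)" "n \<ge> 1"
  shows "herm n z z = of_real (qRe (herm n z z))"
proof -
  have "x = of_real (qRe x)" if "qcnj x = x" for x
    using that by (simp add: quat_eq_iff of_real_def)
  with qcnj_herm[OF assms(1,1,2)] show ?thesis
    by blast
qed


section \<open>Quaternionic hyperbolic space\<close>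

text \<open>
  A point of projective space is the set of all its lifts, i.e. an orbit of nonzero vectors under
  nonzero right scalars.
\<close>

definition vec_rscale :: "quat vec \<Rightarrow> quat \<Rightarrow> quat vec" where
  "vec_rscale z a = map_vec (\<lambda>x. x * a) z"

definition proj :: "quat vec \<Rightarrow> quat vec set" where
  "proj z = {vec_rscale z a | a. a \<noteq> 0}"

definition lift :: "quat vec set \<Rightarrow> quat vec" where
  "lift p = (SOME z. z \<in> p)"

definition V_null :: "nat \<Rightarrow> quat vec set" where
  "V_null n = {z \<in> carrier_vec (n + 1). z \<noteq> 0\<^sub>v (n + 1) \<and> herm n z z = 0}"

text \<open>\<open>herm n z z\<close> is a real quaternion.\<close>

definition V_neg :: "nat \<Rightarrow> quat vec set" where
  "V_neg n = {z \<in> carrier_vec (n + 1). qRe (herm n z z) < 0}"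

definition HH :: "nat \<Rightarrow> quat vec set set" where
  "HH n = proj ` V_neg n"

definition bdHH :: "nat \<Rightarrow> quat vec set set" where
  "bdHH n = proj ` V_null n"

definition clHH :: "nat \<Rightarrow> quat vec set set" where
  "clHH n = HH n \<union> bdHH n"

definition act :: "quat mat \<Rightarrow> quat vec set \<Rightarrow> quat vec set" where
  "act g p = proj (g *\<^sub>v lift p)"

text \<open>The quotient below is a quotient of real quaternions.\<close>

definition rho :: "nat \<Rightarrow> quat vec set \<Rightarrow> quat vec set \<Rightarrow> real" where
  "rho n p q = (THE r. 0 \<le> r \<and>
     of_real ((cosh (r / 2))\<^sup>2) =
       (herm n (lift p) (lift q) * herm n (lift q) (lift p)) /
       (herm n (lift p) (lift p) * herm n (lift q) (lift q)))"

definition herm3 :: "nat \<Rightarrow> quat vec \<Rightarrow> quat vec \<Rightarrow> quat vec \<Rightarrow> quat" where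
  "herm3 n z1 z2 z3 = herm n z2 z1 * herm n z3 z2 * herm n z1 z3"

definition cartan :: "nat \<Rightarrow> quat vec set \<Rightarrow> quat vec set \<Rightarrow> quat vec set \<Rightarrow> real" where
  "cartan n p1 p2 p3 =
     (let t = herm3 n (lift p1) (lift p2) (lift p3) in arccos (qRe (- t) / norm t))"

lemma qcnj_mult: "qcnj (x * y) = qcnj y * qcnj x"
  by (simp add: quat_eq_iff algebra_simps)

lemma herm_rscale:
  assumes "z \<in> carrier_vec (n + 1)" "w \<in> carrier_vec (n + 1)" "n \<ge> 1"
  shows "herm n (vec_rscale z a) (vec_rscale w b) = qcnj b * herm n z w * a"
proof -
  have "vec_rscale z a \<in> carrier_vec (n + 1)" "vec_rscale w b \<in> carrier_vec (n + 1)"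
    using assms by (auto simp: vec_rscale_def)
  with assms show ?thesis
    by (simp add: herm_eq_sum vec_rscale_def qcnj_mult sum_distrib_left sum_distrib_right
        distrib_left distrib_right mult.assoc)
qed

lemma cartan_lift_indep:
  assumes z: "z1 \<in> carrier_vec (n + 1)" "z2 \<in> carrier_vec (n + 1)" "z3 \<in> carrier_vec (n + 1)"
    and n: "n \<ge> 1" and abc: "a \<noteq> 0" "b \<noteq> 0" "c \<noteq> 0"
  defines "t \<equiv> herm3 n z1 z2 z3"
    and "t' \<equiv> herm3 n (vec_rscale z1 a) (vec_rscale z2 b) (vec_rscale z3 c)"
  shows "qRe (- t') / norm t' = qRe (- t) / norm t"
proof -
  have nn: "x * qcnj x = of_real ((norm x)\<^sup>2)" "qcnj x * x = of_real ((norm x)\<^sup>2)" for x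
    by (simp_all add: quat_eq_iff of_real_def norm_quat_def power2_eq_square algebra_simps)
  have Re_conj: "qRe (qcnj x * y * x) = (norm x)\<^sup>2 * qRe y" for x y
    by (simp add: norm_quat_def power2_eq_square algebra_simps)
  have norm_cnj: "norm (qcnj x) = norm x" for x
    by (simp add: norm_quat_def)
  let ?k = "(norm b)\<^sup>2 * (norm c)\<^sup>2"
  have "t' = qcnj a * (herm n z2 z1 * (b * qcnj b) * herm n z3 z2 * (c * qcnj c) * herm n z1 z3) * a"
    using z n by (simp add: t'_def herm3_def herm_rscale mult.assoc)
  also have "\<dots> = ?k *\<^sub>R (qcnj a * t * a)"
    unfolding nn by (simp add: t_def herm3_def of_real_def mult.assoc)
  finally have t': "t' = ?k *\<^sub>R (qcnj a * t * a)" .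
  have "qRe (- t') = (?k * (norm a)\<^sup>2) * qRe (- t)" "norm t' = (?k * (norm a)\<^sup>2) * norm t"
    unfolding t' by (simp_all add: Re_conj norm_mult norm_cnj power2_eq_square del: times_quat.sel)
  with abc show ?thesis
    by simp
qed

definition qline :: "nat \<Rightarrow> quat vec set \<Rightarrow> quat vec set \<Rightarrow> quat vec set set" where
  "qline n u v =
     proj ` ({vec_rscale (lift u) a + vec_rscale (lift v) b | a b. True} - {0\<^sub>v (n + 1)}) \<inter> clHH n"

definition rho_line :: "nat \<Rightarrow> quat vec set set \<Rightarrow> quat vec set \<Rightarrow> real" where
  "rho_line n L z = (INF x\<in>L \<inter> HH n. rho n x z)"

end

theory Submission
  imports Defs
begin

text \<open>
  The Gram matrix of three lifts determines the triple up to isometry. If \<open>z\<^sub>1, z\<^sub>2, z\<^sub>3\<close> and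
  \<open>y\<^sub>1, y\<^sub>2, y\<^sub>3\<close> have the same Gram matrix, and some combination \<open>N\<close> of the \<open>z\<^sub>i\<close> is negative, then
  Witt's theorem (\<open>Witt_extension\<close>) gives \<open>g \<in> Sp n\<close> with \<open>g z\<^sub>i = y\<^sub>i\<close>. It is proved by moving one
  vector at a time, starting with \<open>N\<close>: the quasi-reflection along \<open>x - y\<close> sends \<open>x\<close> to \<open>y\<close> and fixes
  every vector orthogonal to \<open>x - y\<close>, hence the vectors that are already in place. It exists as soon
  as \<open>\<langle>x, x - y\<rangle> \<noteq> 0\<close>, which holds because the orthogonal complement of a negative vector is positive
  definite. In this way linear dependences between the vectors never have to be discussed.

  Replacing the lifts of a triple by other lifts changes its Gram matrix by three nonzero quaternions.
  Their moduli \<open>r\<^sub>1, r\<^sub>2, r\<^sub>3\<close> rescale the moduli of the entries. Once all moduli agree, two of the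
  three remaining unit quaternions are used up to make two off-diagonal entries agree; the last one
  acts on the triple product \<open>\<langle>z\<^sub>2, z\<^sub>1\<rangle>\<langle>z\<^sub>3, z\<^sub>2\<rangle>\<langle>z\<^sub>1, z\<^sub>3\<rangle>\<close> by conjugation. Two quaternions of equal modulus
  are conjugate by a unit exactly when their real parts agree. Hence (\<open>congruent_iff_moduli_similar\<close>) two triples
  are congruent if and only if positive \<open>r\<^sub>1, r\<^sub>2, r\<^sub>3\<close> match seven real numbers: the three
  Hermitian norms, the three moduli of the off-diagonal entries and the real part of the triple product.

  The geometric invariants are functions of these seven numbers. The Cartan invariant is the angle of
  the triple product, \<open>cosh\<^sup>2 (\<rho>/2)\<close> of two points is a quotient of their data, and \<open>cosh\<^sup>2 (\<rho>/2)\<close> of a point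
  and a line is \<open>\<langle>m, m\<rangle> / \<langle>z, z\<rangle>\<close>, where \<open>m\<close> is the orthogonal projection of the lift \<open>z\<close> to the plane
  spanned by the line (\<open>projection_onto_line\<close>, \<open>rho_line_eq\<close>). In each of the four cases it remains to
  see that the listed invariants determine the seven numbers up to the action of
  \<open>r\<^sub>1, r\<^sub>2, r\<^sub>3\<close>; this is elementary algebra (\<open>similar_null_null_null\<close>, \<open>similar_null_null_neg\<close>,
  \<open>similar_null_neg_neg\<close>, \<open>similar_neg_neg_neg\<close>). Non-collinearity enters in the third of these: there the two
  distances to lines satisfy \<open>R (b - 1) = a - 1\<close>, with \<open>a, b\<close> their values of
  \<open>cosh\<^sup>2 (\<rho>/2)\<close> and \<open>R\<close> a ratio of moduli, so they determine \<open>R\<close> unless both equal 1, the value for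
  a point on the line.
\<close>

section \<open>Conjugacy of quaternions\<close>

declare times_quat.sel [simp del]

lemma qcnj_add [simp]: "qcnj (x + y) = qcnj x + qcnj y"
  by (simp add: quat_eq_iff)

lemma qcnj_diff [simp]: "qcnj (x - y) = qcnj x - qcnj y"
  by (simp add: quat_eq_iff)

lemma qcnj_minus [simp]: "qcnj (- x) = - qcnj x"
  by (simp add: quat_eq_iff)

lemma qcnj_0 [simp]: "qcnj 0 = 0" and qcnj_1 [simp]: "qcnj 1 = 1"
  by (simp_all add: quat_eq_iff)

lemma qcnj_qcnj [simp]: "qcnj (qcnj x) = x"
  by (simp add: quat_eq_iff)

lemma norm_qcnj [simp]: "norm (qcnj x) = norm x"
  by (simp add: norm_quat_def)

lemma qcnj_eq_0_iff [simp]: "qcnj x = 0 \<longleftrightarrow> x = 0"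
  by (simp add: quat_eq_iff)

lemma qRe_of_real [simp]: "qRe (of_real r) = r"
  by (simp add: of_real_def)

lemma qcnj_of_real [simp]: "qcnj (of_real r) = of_real r"
  by (simp add: quat_eq_iff of_real_def)

lemma qcnj_scaleR [simp]: "qcnj (r *\<^sub>R x) = r *\<^sub>R qcnj x"
  by (simp add: quat_eq_iff)

lemma of_real_mult_commute: "x * of_real r = of_real r * (x :: quat)"
  by (simp add: of_real_def)

lemma qRe_scaled [simp]: "qRe (of_real r * x) = r * qRe x"
  by (simp add: of_real_def)

lemma qRe_mult_commute: "qRe (x * y) = qRe (y * x)"
  by (simp add: times_quat.sel algebra_simps)

lemma mult_qcnj: "x * qcnj x = of_real ((norm x)\<^sup>2)"
  and qcnj_mult_self: "qcnj x * x = of_real ((norm x)\<^sup>2)"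
  by (simp_all add: quat_eq_iff of_real_def norm_quat_def power2_eq_square times_quat.sel algebra_simps)

lemma qRe_conjugate: "qRe (qcnj a * x * a) = (norm a)\<^sup>2 * qRe x"
  by (simp add: norm_quat_def power2_eq_square times_quat.sel algebra_simps)

lemma abs_qRe_le_norm: "\<bar>qRe x\<bar> \<le> norm x"
  by (rule abs_le_square_iff[THEN iffD2, of "qRe x" "norm x", simplified]) (simp add: norm_quat_def)

text \<open>
  Only the imaginary parts \<open>v\<close> of \<open>t\<close> and \<open>w\<close> of \<open>s\<close> matter. They have the same square, the real
  number \<open>- |v|\<^sup>2\<close>, so every quaternion of the form \<open>w b + b v\<close> intertwines them.
  Unless \<open>t\<close> is real, some such quaternion is nonzero.
\<close>

lemma conjugate_if_norm_eq_Re_eq: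
  assumes nrm: "norm s = norm t" and Re: "qRe s = qRe t"
  obtains a where "norm a = 1" "qcnj a * s * a = t"
proof -
  have "\<exists>a. a \<noteq> 0 \<and> s * a = a * t"
  proof (cases "t = of_real (qRe t)")
    case True
    have "s = t"
      using nrm Re True by (auto simp: quat_eq_iff norm_quat_def of_real_def add_nonneg_eq_0_iff add_nonneg_nonneg)
    then show ?thesis by (intro exI[of _ 1]) simp
  next
    case False
    define v w where "v = t - of_real (qRe t)" and "w = s - of_real (qRe s)"
    have sq: "v * v = w * w"
      using nrm Re unfolding v_def w_def
      by (simp add: quat_eq_iff times_quat.sel of_real_def norm_quat_def power2_eq_square)
    have intertwine: "w * (w * b + b * v) = (w * b + b * v) * v" for b
    proof -
      have "v * v = - of_real ((norm v)\<^sup>2)"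
        by (simp add: quat_eq_iff v_def times_quat.sel of_real_def norm_quat_def power2_eq_square)
      then have "w * w * b = b * (v * v)"
        by (simp add: sq[symmetric] of_real_mult_commute del: of_real_power)
      then show ?thesis by (simp add: distrib_left distrib_right mult.assoc)
    qed
    \<comment> \<open>If b = 1, i, j all failed, then v = -w would commute with i and j.\<close>
    have "\<exists>b. w * b + b * v \<noteq> 0"
    proof (rule ccontr)
      assume "\<not> ?thesis"
      then have "w * 1 + 1 * v = 0" "w * Quat 0 1 0 0 + Quat 0 1 0 0 * v = 0"
        "w * Quat 0 0 1 0 + Quat 0 0 1 0 * v = 0" by blast+
      moreover have "qRe v = 0" by (simp add: v_def)
      ultimately have "v = 0" by (auto simp: quat_eq_iff times_quat.sel)
      with False show False by (simp add: v_def)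
    qed
    then obtain b where b: "w * b + b * v \<noteq> 0" ..
    have "s * (w * b + b * v) = (w * b + b * v) * t"
      using intertwine[of b] Re by (simp add: v_def w_def algebra_simps of_real_mult_commute)
    with b show ?thesis by blast
  qed
  then obtain a where a: "a \<noteq> 0" "s * a = a * t" by blast
  define u where "u = a * of_real (inverse (norm a))"
  have u: "norm u = 1"
    using a by (simp add: u_def norm_mult norm_inverse)
  have "s * u = u * t"
    using a by (simp add: u_def of_real_mult_commute mult.assoc flip: of_real_inverse)
       (metis mult.assoc of_real_mult_commute)
  then have "qcnj u * s * u = t"
    using u by (simp add: mult.assoc) (simp add: mult.assoc[symmetric] qcnj_mult_self)
  with u that show thesis by blast
qed

text \<open>
  The entries \<open>x, y, w\<close> of a Gram matrix change to \<open>cnj a x' b\<close> and so on when the lifts are rescaled by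
  \<open>a, b, c\<close>. Given the moduli, \<open>b\<close> and \<open>c\<close> are forced by the first two equations, and the triple product is
  conjugated by \<open>a\<close> up to a real factor; so \<open>a\<close> must solve a conjugacy problem, and the third
  equation then holds by itself.
\<close>

lemma matching_scalars_exist:
  assumes nz: "x' \<noteq> 0" "y' \<noteq> 0" "w' \<noteq> 0" and r: "0 < r1" "0 < r2" "0 < r3"
    and x: "norm x = r1 * r2 * norm x'" and y: "norm y = r2 * r3 * norm y'"
    and w: "norm w = r1 * r3 * norm w'"
    and Re: "qRe (x * y * w) = (r1 * r2 * r3)\<^sup>2 * qRe (x' * y' * w')"
  obtains a b c where "norm a = r1" "norm b = r2" "norm c = r3"
    "qcnj a * x' * b = x" "qcnj b * y' * c = y" "qcnj c * w' * a = w"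
proof -
  have "norm (of_real ((r1 * r2 * r3)\<^sup>2) * (x' * y' * w')) = norm (x * y * w)"
    using r by (simp add: x y w norm_mult power2_eq_square)
  moreover have "qRe (of_real ((r1 * r2 * r3)\<^sup>2) * (x' * y' * w')) = qRe (x * y * w)"
    by (simp only: qRe_scaled Re)
  ultimately obtain e where e: "norm e = 1"
    "qcnj e * (of_real ((r1 * r2 * r3)\<^sup>2) * (x' * y' * w')) * e = x * y * w"
    by (rule conjugate_if_norm_eq_Re_eq)
  define a where "a = of_real r1 * e"
  define b where "b = inverse (qcnj a * x') * x"
  define c where "c = inverse (qcnj b * y') * y"
  have na: "norm a = r1" using r e by (simp add: a_def norm_mult)
  have nb: "norm b = r2" using nz r by (simp add: b_def norm_mult norm_inverse na x) (simp add: field_simps)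
  have nc: "norm c = r3" using nz r by (simp add: c_def norm_mult norm_inverse nb y) (simp add: field_simps)
  have "qcnj a * x' \<noteq> 0" "qcnj b * y' \<noteq> 0" using na nb nz r by auto
  then have X: "qcnj a * x' * b = x" and Y: "qcnj b * y' * c = y"
    by (simp_all add: b_def c_def flip: mult.assoc)
  have "x * y * (qcnj c * w' * a) = (qcnj a * x' * b) * (qcnj b * y' * c) * (qcnj c * w' * a)"
    by (simp only: X Y)
  also have "\<dots> = qcnj a * x' * (b * qcnj b) * y' * (c * qcnj c) * w' * a"
    by (simp only: mult.assoc)
  also have "\<dots> = qcnj e * (of_real ((r1 * r2 * r3)\<^sup>2) * (x' * y' * w')) * e"
    unfolding mult_qcnj nb nc a_def qcnj_mult qcnj_of_real of_real_def
    by (simp add: mult.assoc power2_eq_square ac_simps)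
  also have "\<dots> = x * y * w" by (rule e(2))
  finally have "x * y * (qcnj c * w' * a) = x * y * w" .
  moreover have "x * y \<noteq> 0"
  proof -
    have "norm (x * y) \<noteq> 0" using r nz by (simp only: norm_mult x y) simp
    then show ?thesis by auto
  qed
  ultimately have "qcnj c * w' * a = w" by simp
  with na nb nc X Y show thesis by (rule that)
qed

section \<open>Projective points and their lifts\<close>

abbreviation rscale :: "quat vec \<Rightarrow> quat \<Rightarrow> quat vec" (infixl "\<cdot>\<^sub>r" 75) where
  "z \<cdot>\<^sub>r a \<equiv> vec_rscale z a"

lemma rscale_carrier [simp]: "z \<cdot>\<^sub>r a \<in> carrier_vec k \<longleftrightarrow> z \<in> carrier_vec k"
  by (simp add: vec_rscale_def)

lemma rscale_index [simp]: "i < dim_vec z \<Longrightarrow> (z \<cdot>\<^sub>r a) $ i = z $ i * a"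
  and rscale_dim [simp]: "dim_vec (z \<cdot>\<^sub>r a) = dim_vec z"
  by (simp_all add: vec_rscale_def)

lemma rscale_rscale [simp]: "z \<cdot>\<^sub>r a \<cdot>\<^sub>r b = z \<cdot>\<^sub>r (a * b)"
  by (rule eq_vecI) (simp_all add: mult.assoc)

lemma rscale_1 [simp]: "z \<cdot>\<^sub>r 1 = z"
  by (rule eq_vecI) simp_all

lemma rscale_eq_0_iff: "z \<in> carrier_vec k \<Longrightarrow> z \<cdot>\<^sub>r a = 0\<^sub>v k \<longleftrightarrow> z = 0\<^sub>v k \<or> a = 0"
  by (auto simp: vec_eq_iff)

lemma proj_rscale: "a \<noteq> 0 \<Longrightarrow> proj (z \<cdot>\<^sub>r a) = proj z"
proof -
  assume a: "a \<noteq> 0"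
  have "z \<cdot>\<^sub>r b \<in> {z \<cdot>\<^sub>r a \<cdot>\<^sub>r c | c. c \<noteq> 0}" if "b \<noteq> 0" for b
  proof -
    have "z \<cdot>\<^sub>r b = z \<cdot>\<^sub>r a \<cdot>\<^sub>r (inverse a * b)" using a by (simp flip: mult.assoc)
    with a that show ?thesis by (metis (mono_tags, lifting) inverse_nonzero_iff_nonzero mem_Collect_eq mult_eq_0_iff)
  qed
  moreover have "z \<cdot>\<^sub>r a \<cdot>\<^sub>r c \<in> {z \<cdot>\<^sub>r b | b. b \<noteq> 0}" if "c \<noteq> 0" for c
    using a that by auto
  ultimately show ?thesis unfolding proj_def by blast
qed

lemma self_in_proj: "z \<in> proj z"
  unfolding proj_def by (auto intro!: exI[of _ 1])

lemma lift_in: "z \<in> p \<Longrightarrow> lift p \<in> p"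
  unfolding lift_def by (rule someI)

lemma lift_proj:
  obtains a where "a \<noteq> 0" "lift (proj z) = z \<cdot>\<^sub>r a"
  using lift_in[OF self_in_proj[of z]] unfolding proj_def by auto

lemma proj_lift_proj: "proj (lift (proj z)) = proj z"
  by (metis lift_proj proj_rscale)

text \<open>
  This reduces congruence of points to congruence of their chosen lifts up to scalars.
\<close>

lemma act_eq_proj_iff: "act h p = proj y \<longleftrightarrow> (\<exists>a. a \<noteq> 0 \<and> h *\<^sub>v lift p = y \<cdot>\<^sub>r a)"
proof
  assume "act h p = proj y"
  then have "h *\<^sub>v lift p \<in> proj y" unfolding act_def using self_in_proj by blast
  then show "\<exists>a. a \<noteq> 0 \<and> h *\<^sub>v lift p = y \<cdot>\<^sub>r a" unfolding proj_def by auto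
qed (auto simp: act_def proj_rscale)

section \<open>Similarity of triples of moduli\<close>

text \<open>
  The numbers stand for the data of three lifts \<open>z\<^sub>1, z\<^sub>2, z\<^sub>3\<close>: the Hermitian norms \<open>A\<^sub>i\<close>, the moduli
  \<open>X = |\<langle>z\<^sub>2, z\<^sub>1\<rangle>|\<close>, \<open>Y = |\<langle>z\<^sub>3, z\<^sub>2\<rangle>|\<close>, \<open>W = |\<langle>z\<^sub>1, z\<^sub>3\<rangle>|\<close>, and the real part \<open>T\<close> of the triple product. The
  relation says how they change when \<open>z\<^sub>i\<close> is rescaled by a quaternion of modulus \<open>r\<^sub>i\<close>.
\<close>

definition moduli_similar where
  "moduli_similar A1 A2 A3 X Y W T B1 B2 B3 X' Y' W' T' \<longleftrightarrow>
     (\<exists>r1>0. \<exists>r2>0. \<exists>r3>0::real.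
       A1 = r1\<^sup>2 * B1 \<and> A2 = r2\<^sup>2 * B2 \<and> A3 = r3\<^sup>2 * B3 \<and>
       X = r1 * r2 * X' \<and> Y = r2 * r3 * Y' \<and> W = r1 * r3 * W' \<and> T = (r1 * r2 * r3)\<^sup>2 * T')"

lemma moduli_similarI:
  fixes r1 r2 r3 :: real
  assumes "0 < r1" "0 < r2" "0 < r3" "A1 = r1\<^sup>2 * B1" "A2 = r2\<^sup>2 * B2" "A3 = r3\<^sup>2 * B3"
    "X = r1 * r2 * X'" "Y = r2 * r3 * Y'" "W = r1 * r3 * W'" "T = (r1 * r2 * r3)\<^sup>2 * T'"
  shows "moduli_similar A1 A2 A3 X Y W T B1 B2 B3 X' Y' W' T'"
  unfolding moduli_similar_def using assms by blast

lemma moduli_similarE: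
  assumes "moduli_similar A1 A2 A3 X Y W T B1 B2 B3 X' Y' W' T'"
  obtains r1 r2 r3 :: real where
    "0 < r1" "0 < r2" "0 < r3" "A1 = r1\<^sup>2 * B1" "A2 = r2\<^sup>2 * B2" "A3 = r3\<^sup>2 * B3"
    "X = r1 * r2 * X'" "Y = r2 * r3 * Y'" "W = r1 * r3 * W'" "T = (r1 * r2 * r3)\<^sup>2 * T'"
  using assms unfolding moduli_similar_def by blast

text \<open>
  The quotient is, up to sign, the cosine of the Cartan invariant.
\<close>

lemma angle_eq_if_similar:
  assumes "moduli_similar A1 A2 A3 X Y W T B1 B2 B3 X' Y' W' T'"
  shows "T / (X * Y * W) = T' / (X' * Y' * W')"
proof -
  obtain r1 r2 r3 where r: "0 < r1" "0 < r2" "0 < r3" "X = r1 * r2 * X'" "Y = r2 * r3 * Y'"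
    "W = r1 * r3 * W'" "T = (r1 * r2 * r3)\<^sup>2 * T'"
    using assms by (rule moduli_similarE)
  have "X * Y * W = (r1 * r2 * r3)\<^sup>2 * (X' * Y' * W')"
    unfolding r by (simp add: power2_eq_square)
  then show ?thesis unfolding r(7) using r(1-3) by simp
qed

lemma triple_eq_if_angle_eq:
  fixes X :: real
  assumes pos: "0 < X" "0 < Y" "0 < W" and r: "0 < r1" "0 < r2" "0 < r3"
    and eqs: "X = r1 * r2 * X'" "Y = r2 * r3 * Y'" "W = r1 * r3 * W'"
    and angle: "T / (X * Y * W) = T' / (X' * Y' * W')"
  shows "T = (r1 * r2 * r3)\<^sup>2 * T'"
proof -
  have e: "X * Y * W = (r1 * r2 * r3)\<^sup>2 * (X' * Y' * W')"
    unfolding eqs by (simp add: power2_eq_square)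
  have "X * Y * W \<noteq> 0" using pos by simp
  then have "T = X * Y * W * (T' / (X' * Y' * W'))"
    using angle by (simp add: field_simps)
  also have "\<dots> = (r1 * r2 * r3)\<^sup>2 * T'"
    using \<open>X * Y * W \<noteq> 0\<close> unfolding e by simp
  finally show ?thesis .
qed

lemma distance_eq_if_similar:
  assumes "moduli_similar A1 A2 A3 X Y W T B1 B2 B3 X' Y' W' T'"
  shows "X\<^sup>2 / (A1 * A2) = X'\<^sup>2 / (B1 * B2)" "Y\<^sup>2 / (A2 * A3) = Y'\<^sup>2 / (B2 * B3)"
    "W\<^sup>2 / (A1 * A3) = W'\<^sup>2 / (B1 * B3)"
proof -
  obtain r1 r2 r3 where r: "0 < r1" "0 < r2" "0 < r3" "A1 = r1\<^sup>2 * B1" "A2 = r2\<^sup>2 * B2" "A3 = r3\<^sup>2 * B3"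
    "X = r1 * r2 * X'" "Y = r2 * r3 * Y'" "W = r1 * r3 * W'" "T = (r1 * r2 * r3)\<^sup>2 * T'"
    using assms by (rule moduli_similarE)
  have "X\<^sup>2 = (r1 * r2)\<^sup>2 * X'\<^sup>2" "A1 * A2 = (r1 * r2)\<^sup>2 * (B1 * B2)"
    "Y\<^sup>2 = (r2 * r3)\<^sup>2 * Y'\<^sup>2" "A2 * A3 = (r2 * r3)\<^sup>2 * (B2 * B3)"
    "W\<^sup>2 = (r1 * r3)\<^sup>2 * W'\<^sup>2" "A1 * A3 = (r1 * r3)\<^sup>2 * (B1 * B3)"
    unfolding r(4-) by (simp_all add: power_mult_distrib)
  with r(1-3) show "X\<^sup>2 / (A1 * A2) = X'\<^sup>2 / (B1 * B2)" "Y\<^sup>2 / (A2 * A3) = Y'\<^sup>2 / (B2 * B3)"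
    "W\<^sup>2 / (A1 * A3) = W'\<^sup>2 / (B1 * B3)" by simp_all
qed

text \<open>
  The norms and the distance of two negative points determine the modulus of their Hermitian product.
\<close>

lemma side_eq_if_distance_eq:
  fixes X :: real
  assumes "0 < X" "0 < X'" "0 < r1" "0 < r2" "A1 = r1\<^sup>2 * B1" "A2 = r2\<^sup>2 * B2" "B1 < 0" "B2 < 0"
    and eq: "X\<^sup>2 / (A1 * A2) = X'\<^sup>2 / (B1 * B2)"
  shows "X = r1 * r2 * X'"
proof -
  have "X\<^sup>2 = (r1 * r2 * X')\<^sup>2"
    using eq assms by (simp add: field_simps)
  with assms(1-4) show ?thesis by (simp add: power2_eq_iff_nonneg)
qed

text \<open>
  The value of \<open>cosh\<^sup>2 (\<rho>/2)\<close> for the distance from the third point to the line through the first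
  two: \<open>(A\<^sub>1 A\<^sub>2 - X\<^sup>2)\<close> is the Gram determinant of the line, and the numerator divided by it is the
  Hermitian norm of the projection of \<open>z\<^sub>3\<close>.
\<close>

definition line_ratio :: "real \<Rightarrow> real \<Rightarrow> real \<Rightarrow> real \<Rightarrow> real \<Rightarrow> real \<Rightarrow> real \<Rightarrow> real" where
  "line_ratio A1 A2 A3 X Y W T = (A2 * W\<^sup>2 + A1 * Y\<^sup>2 - 2 * T) / ((A1 * A2 - X\<^sup>2) * A3)"

lemma line_ratio_eq_if_similar:
  assumes "moduli_similar A1 A2 A3 X Y W T B1 B2 B3 X' Y' W' T'"
  shows "line_ratio A1 A2 A3 X Y W T = line_ratio B1 B2 B3 X' Y' W' T'"
proof -
  obtain r1 r2 r3 where r: "0 < r1" "0 < r2" "0 < r3" "A1 = r1\<^sup>2 * B1" "A2 = r2\<^sup>2 * B2" "A3 = r3\<^sup>2 * B3"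
    "X = r1 * r2 * X'" "Y = r2 * r3 * Y'" "W = r1 * r3 * W'" "T = (r1 * r2 * r3)\<^sup>2 * T'"
    using assms by (rule moduli_similarE)
  have "A2 * W\<^sup>2 + A1 * Y\<^sup>2 - 2 * T = (r1 * r2 * r3)\<^sup>2 * (B2 * W'\<^sup>2 + B1 * Y'\<^sup>2 - 2 * T')"
    "(A1 * A2 - X\<^sup>2) * A3 = (r1 * r2 * r3)\<^sup>2 * ((B1 * B2 - X'\<^sup>2) * B3)"
    unfolding r(4-) by (simp_all add: power2_eq_square algebra_simps)
  with r(1-3) show ?thesis by (simp add: line_ratio_def)
qed

text \<open>
  Exchanging the last two lifts exchanges \<open>X\<close> and \<open>W\<close> and conjugates the triple product.
\<close>

lemma moduli_similar_swap23:
  assumes "moduli_similar A1 A2 A3 X Y W T B1 B2 B3 X' Y' W' T'"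
  shows "moduli_similar A1 A3 A2 W Y X T B1 B3 B2 W' Y' X' T'"
proof -
  obtain r1 r2 r3 where r: "0 < r1" "0 < r2" "0 < r3" "A1 = r1\<^sup>2 * B1" "A2 = r2\<^sup>2 * B2" "A3 = r3\<^sup>2 * B3"
    "X = r1 * r2 * X'" "Y = r2 * r3 * Y'" "W = r1 * r3 * W'" "T = (r1 * r2 * r3)\<^sup>2 * T'"
    using assms by (rule moduli_similarE)
  show ?thesis
    by (rule moduli_similarI[OF r(1) r(3) r(2)]) (simp_all add: r mult_ac)
qed

lemma sqrt_ratio:
  fixes A :: real
  assumes "A < 0" "B < 0"
  shows "0 < sqrt (A / B)" "A = (sqrt (A / B))\<^sup>2 * B"
proof -
  have "0 < A / B" using assms by (simp add: divide_neg_neg)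
  with assms show "0 < sqrt (A / B)" "A = (sqrt (A / B))\<^sup>2 * B" by simp_all
qed

text \<open>
  For three null vectors the \<open>r\<^sub>i\<close> can be chosen to match any three moduli; the angle then gives \<open>T\<close>.
\<close>

lemma similar_null_null_null:
  assumes pos: "0 < X" "0 < Y" "0 < W" "0 < X'" "0 < Y'" "0 < W'"
  shows "moduli_similar 0 0 0 X Y W T 0 0 0 X' Y' W' T' \<longleftrightarrow> T / (X * Y * W) = T' / (X' * Y' * W')"
proof
  assume angle: "T / (X * Y * W) = T' / (X' * Y' * W')"
  define x y w where "x = X / X'" and "y = Y / Y'" and "w = W / W'"
  have q: "0 < x" "0 < y" "0 < w" using pos by (simp_all add: x_def y_def w_def)
  \<comment> \<open>the solution of \<open>r1 r2 = x\<close>, \<open>r2 r3 = y\<close>, \<open>r1 r3 = w\<close>\<close>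
  define r1 r2 r3 where "r1 = sqrt (x * w / y)" and "r2 = sqrt (x * y / w)" and "r3 = sqrt (y * w / x)"
  have r: "0 < r1" "0 < r2" "0 < r3" using q by (simp_all add: r1_def r2_def r3_def)
  have "r1 * r2 = sqrt (x * x)" "r2 * r3 = sqrt (y * y)" "r1 * r3 = sqrt (w * w)"
    using q by (simp_all add: r1_def r2_def r3_def flip: real_sqrt_mult)
  then have "r1 * r2 = x" "r2 * r3 = y" "r1 * r3 = w" using q by simp_all
  then have e: "X = r1 * r2 * X'" "Y = r2 * r3 * Y'" "W = r1 * r3 * W'"
    using pos by (simp_all add: x_def y_def w_def)
  from triple_eq_if_angle_eq[OF pos(1-3) r e angle]
  show "moduli_similar 0 0 0 X Y W T 0 0 0 X' Y' W' T'"
    by (intro moduli_similarI[OF r]) (simp_all add: e)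
qed (rule angle_eq_if_similar)

text \<open>
  The norm \<open>A\<^sub>3\<close> and the moduli \<open>Y, W\<close> fix all the \<open>r\<^sub>i\<close>. The distance to the line, which here is
  \<open>2 T / (X\<^sup>2 A\<^sub>3)\<close>, then gives \<open>X\<close>, because \<open>T\<close> is \<open>X Y W\<close> times a factor \<open>k\<close> known from the angle. Dividing by \<open>k\<close> is possible because
  the distance expression is nonzero.
\<close>

lemma similar_null_null_neg:
  assumes pos: "0 < X" "0 < Y" "0 < W" "0 < X'" "0 < Y'" "0 < W'" and neg: "A3 < 0" "B3 < 0"
    and nz: "line_ratio 0 0 A3 X Y W T \<noteq> 0"
  shows "moduli_similar 0 0 A3 X Y W T 0 0 B3 X' Y' W' T' \<longleftrightarrow>
    T / (X * Y * W) = T' / (X' * Y' * W') \<and> line_ratio 0 0 A3 X Y W T = line_ratio 0 0 B3 X' Y' W' T'"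
    (is "?L \<longleftrightarrow> ?angle \<and> ?line")
proof
  assume "?angle \<and> ?line"
  then have angle: ?angle and line: ?line by auto
  define k where "k = T / (X * Y * W)"
  define r3 r1 r2 where "r3 = sqrt (A3 / B3)" and "r1 = W / (r3 * W')" and "r2 = Y / (r3 * Y')"
  have r3: "0 < r3" "A3 = r3\<^sup>2 * B3" unfolding r3_def using sqrt_ratio[OF neg] .
  have r: "0 < r1" "0 < r2" using r3 pos by (simp_all add: r1_def r2_def)
  have YW: "Y = r2 * r3 * Y'" "W = r1 * r3 * W'" using r3 pos by (simp_all add: r1_def r2_def)
  have T: "T = k * (X * Y * W)" using pos by (simp add: k_def)
  have T': "T' = k * (X' * Y' * W')" using pos unfolding k_def angle by simp
  have k: "k \<noteq> 0" using nz by (auto simp: line_ratio_def T)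
  have "k * (Y * W / (X * A3)) = k * (Y' * W' / (X' * B3))"
    using line pos neg by (simp add: line_ratio_def T T' power2_eq_square)
  then have "Y * W / (X * A3) = Y' * W' / (X' * B3)" using k by (simp only: mult_cancel_left) simp
  then have "Y * W * (X' * B3) = Y' * W' * (X * A3)" using pos neg by (simp add: frac_eq_eq)
  then have "(Y' * W' * r3\<^sup>2 * B3) * (r1 * r2 * X') = (Y' * W' * r3\<^sup>2 * B3) * X"
    unfolding YW r3(2) by (simp add: power2_eq_square mult_ac)
  moreover have "Y' * W' * r3\<^sup>2 * B3 \<noteq> 0" using pos neg r3 by simp
  ultimately have X: "X = r1 * r2 * X'" by simp
  show ?L
    by (rule moduli_similarI[OF r r3(1) _ _ r3(2) X YW
          triple_eq_if_angle_eq[OF pos(1-3) r r3(1) X YW angle]]) simp_all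
qed (auto dest: angle_eq_if_similar line_ratio_eq_if_similar)

text \<open>
  With \<open>R = A\<^sub>2 W\<^sup>2 / (X\<^sup>2 A\<^sub>3)\<close> and \<open>S = 2 T / (X\<^sup>2 A\<^sub>3)\<close> the two distances to lines are \<open>a = S - R\<close> and
  \<open>b = (S - 1) / R\<close>. Eliminating \<open>S\<close> gives \<open>R (b - 1) = a - 1\<close>, so that \<open>R\<close>, and then \<open>S\<close>, is determined
  when \<open>a \<noteq> 1\<close>. The angle is then determined as well, through \<open>S\<close>.
\<close>

lemma similar_null_neg_neg:
  assumes pos: "0 < X" "0 < Y" "0 < W" "0 < X'" "0 < Y'" "0 < W'"
    and neg: "A2 < 0" "A3 < 0" "B2 < 0" "B3 < 0"
    and ne1: "line_ratio 0 A2 A3 X Y W T \<noteq> 1"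
  shows "moduli_similar 0 A2 A3 X Y W T 0 B2 B3 X' Y' W' T' \<longleftrightarrow>
    line_ratio 0 A2 A3 X Y W T = line_ratio 0 B2 B3 X' Y' W' T' \<and>
    line_ratio 0 A3 A2 W Y X T = line_ratio 0 B3 B2 W' Y' X' T' \<and>
    Y\<^sup>2 / (A2 * A3) = Y'\<^sup>2 / (B2 * B3)"
    (is "?L \<longleftrightarrow> ?line3 \<and> ?line2 \<and> ?dist")
proof
  assume "?line3 \<and> ?line2 \<and> ?dist"
  then have line3: ?line3 and line2: ?line2 and dist: ?dist by auto
  define R S where "R = A2 * W\<^sup>2 / (X\<^sup>2 * A3)" and "S = 2 * T / (X\<^sup>2 * A3)"
  define R' S' where "R' = B2 * W'\<^sup>2 / (X'\<^sup>2 * B3)" and "S' = 2 * T' / (X'\<^sup>2 * B3)"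
  have l3: "line_ratio 0 A2 A3 X Y W T = S - R" "line_ratio 0 B2 B3 X' Y' W' T' = S' - R'"
    by (simp_all add: line_ratio_def R_def S_def R'_def S'_def diff_divide_distrib)
  have l2: "R * line_ratio 0 A3 A2 W Y X T = S - 1" "R' * line_ratio 0 B3 B2 W' Y' X' T' = S' - 1"
    using pos neg by (simp_all add: line_ratio_def R_def S_def R'_def S'_def field_simps)
  define a b where "a = line_ratio 0 A2 A3 X Y W T" and "b = line_ratio 0 A3 A2 W Y X T"
  have ab: "a = S - R" "a = S' - R'" "R * b = S - 1" "R' * b = S' - 1"
    using l3 l2 line3 line2 by (simp_all add: a_def b_def)
  then have "R * (b - 1) = a - 1" "R' * (b - 1) = a - 1" by (simp_all add: algebra_simps)
  moreover from this have "b \<noteq> 1" using ne1 by (auto simp: a_def)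
  ultimately have R: "R = R'" by (metis mult_right_cancel right_minus_eq)
  then have S: "S = S'" using ab by simp
  define r2 r3 r1 where "r2 = sqrt (A2 / B2)" and "r3 = sqrt (A3 / B3)" and "r1 = X / (r2 * X')"
  have r2: "0 < r2" "A2 = r2\<^sup>2 * B2" unfolding r2_def using sqrt_ratio[OF neg(1,3)] .
  have r3: "0 < r3" "A3 = r3\<^sup>2 * B3" unfolding r3_def using sqrt_ratio[OF neg(2,4)] .
  have r1: "0 < r1" using r2 pos by (simp add: r1_def)
  have X: "X = r1 * r2 * X'" using r2 pos by (simp add: r1_def)
  have Y: "Y = r2 * r3 * Y'"
    by (rule side_eq_if_distance_eq[OF pos(2,5) r2(1) r3(1) r2(2) r3(2) neg(3,4) dist])
  have W: "W = r1 * r3 * W'"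
  proof -
    have "W\<^sup>2 * (A2 * (X'\<^sup>2 * B3)) = W'\<^sup>2 * (B2 * (X\<^sup>2 * A3))"
      using R pos neg by (simp add: R_def R'_def frac_eq_eq mult_ac)
    then have "(r2\<^sup>2 * B2 * X'\<^sup>2 * B3) * W\<^sup>2 = (r2\<^sup>2 * B2 * X'\<^sup>2 * B3) * (r1 * r3 * W')\<^sup>2"
      unfolding X r2(2) r3(2) by (simp add: power_mult_distrib mult_ac)
    moreover have "r2\<^sup>2 * B2 * X'\<^sup>2 * B3 \<noteq> 0" using r2 pos neg by simp
    ultimately have "W\<^sup>2 = (r1 * r3 * W')\<^sup>2" by simp
    with pos r1 r3 show ?thesis by (simp add: power2_eq_iff_nonneg)
  qed
  have T: "T = (r1 * r2 * r3)\<^sup>2 * T'"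
  proof -
    have "T * (X'\<^sup>2 * B3) = T' * (X\<^sup>2 * A3)"
      using S pos neg by (simp add: S_def S'_def frac_eq_eq mult_ac)
    then have "(X'\<^sup>2 * B3) * T = (X'\<^sup>2 * B3) * ((r1 * r2 * r3)\<^sup>2 * T')"
      unfolding X r3(2) by (simp add: power_mult_distrib mult_ac)
    moreover have "X'\<^sup>2 * B3 \<noteq> 0" using pos neg by simp
    ultimately show ?thesis by simp
  qed
  show ?L by (rule moduli_similarI[OF r1 r2(1) r3(1) _ r2(2) r3(2) X Y W T]) simp
next
  assume ?L
  with line_ratio_eq_if_similar[OF this] line_ratio_eq_if_similar[OF moduli_similar_swap23[OF this]]
    distance_eq_if_similar(2)[OF this]
  show "?line3 \<and> ?line2 \<and> ?dist" by simp
qed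

text \<open>
  The norms fix all the \<open>r\<^sub>i\<close>, and the distances then give the three moduli.
\<close>

lemma similar_neg_neg_neg:
  assumes pos: "0 < X" "0 < Y" "0 < W" "0 < X'" "0 < Y'" "0 < W'"
    and neg: "A1 < 0" "A2 < 0" "A3 < 0" "B1 < 0" "B2 < 0" "B3 < 0"
  shows "moduli_similar A1 A2 A3 X Y W T B1 B2 B3 X' Y' W' T' \<longleftrightarrow>
    T / (X * Y * W) = T' / (X' * Y' * W') \<and> X\<^sup>2 / (A1 * A2) = X'\<^sup>2 / (B1 * B2) \<and>
    W\<^sup>2 / (A1 * A3) = W'\<^sup>2 / (B1 * B3) \<and> Y\<^sup>2 / (A2 * A3) = Y'\<^sup>2 / (B2 * B3)"
    (is "?L \<longleftrightarrow> ?angle \<and> ?dX \<and> ?dW \<and> ?dY")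
proof
  assume "?angle \<and> ?dX \<and> ?dW \<and> ?dY"
  then have angle: ?angle and dX: ?dX and dW: ?dW and dY: ?dY by auto
  note r1 = sqrt_ratio[OF neg(1,4)] and r2 = sqrt_ratio[OF neg(2,5)] and r3 = sqrt_ratio[OF neg(3,6)]
  note X = side_eq_if_distance_eq[OF pos(1,4) r1(1) r2(1) r1(2) r2(2) neg(4,5) dX]
    and Y = side_eq_if_distance_eq[OF pos(2,5) r2(1) r3(1) r2(2) r3(2) neg(5,6) dY]
    and W = side_eq_if_distance_eq[OF pos(3,6) r1(1) r3(1) r1(2) r3(2) neg(4,6) dW]
  show ?L
    by (rule moduli_similarI[OF r1(1) r2(1) r3(1) r1(2) r2(2) r3(2) X Y W
          triple_eq_if_angle_eq[OF pos(1-3) r1(1) r2(1) r3(1) X Y W angle]])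
next
  assume ?L
  with angle_eq_if_similar[OF this] distance_eq_if_similar[OF this]
  show "?angle \<and> ?dX \<and> ?dW \<and> ?dY" by simp
qed

section \<open>The Hermitian form\<close>

lemma mat_eq_if_action_eq:
  fixes A B :: "quat mat"
  assumes "A \<in> carrier_mat k m" "B \<in> carrier_mat k m"
    and "\<And>z. z \<in> carrier_vec m \<Longrightarrow> A *\<^sub>v z = B *\<^sub>v z"
  shows "A = B"
proof (rule eq_matI)
  fix i j assume ij: "i < dim_row B" "j < dim_col B"
  have "(A *\<^sub>v unit_vec m j) $ i = (B *\<^sub>v unit_vec m j) $ i"
    using assms(3) by simp
  with ij assms(1,2) show "A $$ (i, j) = B $$ (i, j)"
    by simp
qed (use assms in auto)

text \<open>
  The defining property of the adjoint, as needed to turn \<open>g\<^sup>* J g = J\<close> into invariance of the form.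
\<close>

lemma cnj_scalar_prod_adjoint:
  assumes "g \<in> carrier_mat m m" "w \<in> carrier_vec m" "v \<in> carrier_vec m"
  shows "map_vec qcnj (g *\<^sub>v w) \<bullet> v = map_vec qcnj w \<bullet> (adjoint_mat g *\<^sub>v v)"
proof -
  have "map_vec qcnj (g *\<^sub>v w) \<bullet> v
      = (\<Sum>i\<in>{0..<m}. \<Sum>j\<in>{0..<m}. qcnj (w $ j) * (qcnj (g $$ (i, j)) * v $ i))"
    using assms by (simp add: scalar_prod_def qcnj_sum qcnj_mult sum_distrib_right mult.assoc)
  also have "\<dots> = (\<Sum>j\<in>{0..<m}. \<Sum>i\<in>{0..<m}. qcnj (w $ j) * (qcnj (g $$ (i, j)) * v $ i))"
    by (rule sum.swap)
  also have "\<dots> = map_vec qcnj w \<bullet> (adjoint_mat g *\<^sub>v v)"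
    using assms by (simp add: scalar_prod_def adjoint_mat_def sum_distrib_left)
  finally show ?thesis .
qed

lemma Jmat_carrier [simp]: "Jmat n \<in> carrier_mat (n + 1) (n + 1)"
  by (simp add: Jmat_def)

lemma adjoint_mat_carrier [simp]: "g \<in> carrier_mat m m \<Longrightarrow> adjoint_mat g \<in> carrier_mat m m"
  by (simp add: adjoint_mat_def)

context
  fixes n :: nat
  assumes n: "1 \<le> n"
begin

abbreviation hform ("\<langle>_,/ _\<rangle>") where "\<langle>z, w\<rangle> \<equiv> herm n z w"

abbreviation hnorm where "hnorm z \<equiv> qRe \<langle>z, z\<rangle>"

abbreviation space where "space \<equiv> carrier_vec (n + 1) :: quat vec set"

lemma herm_add_left:
  assumes "z \<in> space" "z' \<in> space" "w \<in> space"
  shows "\<langle>z + z', w\<rangle> = \<langle>z, w\<rangle> + \<langle>z', w\<rangle>"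
  using assms n by (simp add: herm_eq_sum sum.distrib distrib_left)

lemma herm_diff_left:
  assumes "z \<in> space" "z' \<in> space" "w \<in> space"
  shows "\<langle>z - z', w\<rangle> = \<langle>z, w\<rangle> - \<langle>z', w\<rangle>"
  using assms n by (simp add: herm_eq_sum sum_subtractf right_diff_distrib)

lemma herm_add_right:
  assumes "z \<in> space" "z' \<in> space" "w \<in> space"
  shows "\<langle>w, z + z'\<rangle> = \<langle>w, z\<rangle> + \<langle>w, z'\<rangle>"
  using assms n by (simp add: herm_eq_sum sum.distrib distrib_right)

lemma herm_diff_right:
  assumes "z \<in> space" "z' \<in> space" "w \<in> space"
  shows "\<langle>w, z - z'\<rangle> = \<langle>w, z\<rangle> - \<langle>w, z'\<rangle>"
  using assms n by (simp add: herm_eq_sum sum_subtractf left_diff_distrib)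

lemma herm_rscale_left:
  assumes "z \<in> space" "w \<in> space"
  shows "\<langle>z \<cdot>\<^sub>r a, w\<rangle> = \<langle>z, w\<rangle> * a"
  using herm_rscale[OF assms n, of a 1] by simp

lemma herm_rscale_right:
  assumes "z \<in> space" "w \<in> space"
  shows "\<langle>z, w \<cdot>\<^sub>r a\<rangle> = qcnj a * \<langle>z, w\<rangle>"
  using herm_rscale[OF assms n, of 1 a] by simp

lemmas herm_simps = herm_add_left herm_diff_left herm_add_right herm_diff_right
  herm_rscale_left herm_rscale_right

lemma herm_self: "z \<in> space \<Longrightarrow> \<langle>z, z\<rangle> = of_real (hnorm z)"
  by (rule herm_self_real[OF _ n])

lemma cnj_herm: "z \<in> space \<Longrightarrow> w \<in> space \<Longrightarrow> qcnj \<langle>z, w\<rangle> = \<langle>w, z\<rangle>"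
  by (rule qcnj_herm[OF _ _ n])

lemma hnorm_rscale: "z \<in> space \<Longrightarrow> hnorm (z \<cdot>\<^sub>r a) = (norm a)\<^sup>2 * hnorm z"
  using n by (simp add: herm_rscale qRe_conjugate)

lemma norm_herm_commute: "z \<in> space \<Longrightarrow> w \<in> space \<Longrightarrow> norm \<langle>z, w\<rangle> = norm \<langle>w, z\<rangle>"
  by (metis cnj_herm norm_qcnj)

lemma herm_0_left: "w \<in> space \<Longrightarrow> \<langle>0\<^sub>v (n + 1), w\<rangle> = 0"
  using n by (simp add: herm_eq_sum)

text \<open>
  On vectors with vanishing first coordinate the form is a sum of squares in which the last coordinate
  does not occur. Subtracting a multiple of a given vector makes the first coordinate vanish, which
  replaces any discussion of signatures.
\<close>

lemma hnorm_first_0: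
  assumes "z \<in> space" "z $ 0 = 0"
  shows "hnorm z = (\<Sum>i\<in>{1..<n}. (norm (z $ i))\<^sup>2)"
  using assms n by (simp add: herm_eq_sum qcnj_mult_self flip: of_real_sum of_real_power)

lemma hnorm_first_0_eq_0:
  assumes "z \<in> space" "z $ 0 = 0" "hnorm z \<le> 0"
  shows "\<forall>i<n. z $ i = 0"
proof -
  have "(\<Sum>i\<in>{1..<n}. (norm (z $ i))\<^sup>2) = 0"
    using hnorm_first_0[OF assms(1,2)] assms(3) by (smt (verit) sum_nonneg zero_le_power2)
  then have "\<forall>i\<in>{1..<n}. z $ i = 0" by (simp add: sum_nonneg_eq_0_iff)
  with assms(2) show ?thesis by (metis One_nat_def atLeastLessThan_iff less_one not_less_eq not_le)
qed

text \<open>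
  The orthogonal complement of a negative vector is positive definite, and that of a null vector is positive
  semidefinite with the vector itself as only null direction. If \<open>N\<close> has nonzero first coordinate,
  choose \<open>s\<close> such that \<open>w - N s\<close> has first coordinate zero; its norm is \<open>\<langle>w, w\<rangle> + |s|\<^sup>2 \<langle>N, N\<rangle>\<close>,
  and it is a sum of squares. If \<open>N\<close> has first coordinate zero, it is a multiple of the last basis vector.
\<close>

lemma orthogonal_semidefinite:
  assumes N: "N \<in> space" "N \<noteq> 0\<^sub>v (n + 1)" "hnorm N \<le> 0"
    and w: "w \<in> space" and orth: "\<langle>w, N\<rangle> = 0"
  shows "0 \<le> hnorm w" and "hnorm w = 0 \<Longrightarrow> \<exists>s. w = N \<cdot>\<^sub>r s"
proof -
  have main: "0 \<le> hnorm w \<and> (hnorm w = 0 \<longrightarrow> (\<exists>s. w = N \<cdot>\<^sub>r s))"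
  proof (cases "N $ 0 = 0")
    case True
    have N0: "\<forall>i<n. N $ i = 0" by (rule hnorm_first_0_eq_0) (use N True in auto)
    have "N $ n \<noteq> 0"
    proof
      assume "N $ n = 0"
      with N0 N(1) have "N = 0\<^sub>v (n + 1)" by (intro eq_vecI) (auto simp: less_Suc_eq)
      with N(2) show False ..
    qed
    have "\<langle>w, N\<rangle> = qcnj (N $ n) * w $ 0"
      using N0 N w n by (simp add: herm_eq_sum)
    with orth \<open>N $ n \<noteq> 0\<close> have w0: "w $ 0 = 0" by simp
    have "0 \<le> hnorm w" using hnorm_first_0[OF w w0] by (simp add: sum_nonneg)
    moreover have "w = N \<cdot>\<^sub>r (inverse (N $ n) * w $ n)" if "hnorm w = 0"
    proof -
      have "\<forall>i<n. w $ i = 0" by (rule hnorm_first_0_eq_0) (use w w0 that in auto)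
      with N0 N(1) w \<open>N $ n \<noteq> 0\<close> show ?thesis
        by (intro eq_vecI) (auto simp: less_Suc_eq mult.assoc[symmetric])
    qed
    ultimately show ?thesis by blast
  next
    case False
    define s where "s = inverse (N $ 0) * w $ 0"
    define w' where "w' = w - N \<cdot>\<^sub>r s"
    have w': "w' \<in> space" "w' $ 0 = 0"
      using N w False by (simp_all add: w'_def s_def mult.assoc[symmetric])
    have orth': "\<langle>N, w\<rangle> = 0" using cnj_herm[of w N] orth N w by simp
    have "\<langle>w', w'\<rangle> = \<langle>w, w\<rangle> + qcnj s * \<langle>N, N\<rangle> * s"
      using N w orth orth' by (simp add: w'_def herm_simps mult.assoc)
    then have eq: "hnorm w' = hnorm w + (norm s)\<^sup>2 * hnorm N"
      by (simp add: qRe_conjugate)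
    have ge: "0 \<le> hnorm w'" using hnorm_first_0[OF w'] by (simp add: sum_nonneg)
    have le: "(norm s)\<^sup>2 * hnorm N \<le> 0" using N(3) by (simp add: mult_nonneg_nonpos)
    have "\<exists>s. w = N \<cdot>\<^sub>r s" if "hnorm w = 0"
    proof -
      have "hnorm w' \<le> 0" and s0: "(norm s)\<^sup>2 * hnorm N = 0" using that eq ge le by auto
      then have z: "\<forall>i<n. w' $ i = 0" using hnorm_first_0_eq_0[OF w'] by blast
      have "qcnj (N $ 0) * w' $ n = \<langle>w', N\<rangle>"
        using z N w' n by (simp add: herm_eq_sum)
      also have "\<dots> = - of_real (hnorm N) * s"
        using N w orth herm_self[of N] by (simp add: w'_def herm_simps)
      also have "\<dots> = 0" using s0 by auto
      finally have "w' $ n = 0" using False by simp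
      with z w' have "w' = 0\<^sub>v (n + 1)" by (intro eq_vecI) (auto simp: less_Suc_eq)
      then have "\<forall>i<n+1. (w - N \<cdot>\<^sub>r s) $ i = 0" by (simp add: w'_def)
      then have "w = N \<cdot>\<^sub>r s" using N w by (intro eq_vecI) auto
      then show ?thesis ..
    qed
    with eq ge le show ?thesis by auto
  qed
  from main show "0 \<le> hnorm w" "hnorm w = 0 \<Longrightarrow> \<exists>s. w = N \<cdot>\<^sub>r s" by auto
qed

text \<open>
  Apply semidefiniteness of the orthogonal complement to the component of \<open>w\<close> orthogonal to \<open>N\<close>.
\<close>

lemma reverse_Cauchy_Schwarz:
  assumes N: "N \<in> space" "hnorm N < 0" and w: "w \<in> space"
  shows "hnorm N * hnorm w \<le> (norm \<langle>w, N\<rangle>)\<^sup>2"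
    and "hnorm N * hnorm w = (norm \<langle>w, N\<rangle>)\<^sup>2 \<Longrightarrow> w = N \<cdot>\<^sub>r (of_real (inverse (hnorm N)) * \<langle>w, N\<rangle>)"
proof -
  define s where "s = of_real (inverse (hnorm N)) * \<langle>w, N\<rangle>"
  define w' where "w' = w - N \<cdot>\<^sub>r s"
  have N0: "N \<noteq> 0\<^sub>v (n + 1)" using N herm_0_left[OF N(1)] by auto
  have w': "w' \<in> space" using N w by (simp add: w'_def)
  have Ns: "\<langle>N, N\<rangle> * s = \<langle>w, N\<rangle>"
  proof -
    have "of_real (hnorm N) * of_real (inverse (hnorm N)) = (1 :: quat)"
      using N(2) by (subst of_real_mult[symmetric]) simp
    then show ?thesis
      by (subst herm_self[OF N(1)]) (simp add: s_def mult.assoc[symmetric] del: of_real_inverse)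
  qed
  have orth: "\<langle>w', N\<rangle> = 0"
    using N w Ns by (simp add: w'_def herm_simps)
  have "\<langle>w', w'\<rangle> = \<langle>w', w\<rangle>"
    using N w w' orth by (subst (2) w'_def) (simp add: herm_simps)
  also have "\<dots> = \<langle>w, w\<rangle> - \<langle>N, w\<rangle> * s"
    using N w by (simp add: w'_def herm_simps)
  also have "\<langle>N, w\<rangle> * s = of_real (inverse (hnorm N) * (norm \<langle>w, N\<rangle>)\<^sup>2)"
    unfolding s_def cnj_herm[OF w N(1), symmetric] mult.assoc[symmetric] of_real_mult_commute
    unfolding mult.assoc qcnj_mult_self of_real_mult ..
  finally have nw': "hnorm w' = hnorm w - inverse (hnorm N) * (norm \<langle>w, N\<rangle>)\<^sup>2"
    by (simp only: minus_quat.sel qRe_of_real)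
  have "0 \<le> hnorm w'" using orthogonal_semidefinite(1)[OF N(1) N0 _ w' orth] N(2) by simp
  then have "hnorm N * hnorm w' \<le> 0" using N(2) by (simp add: mult_nonpos_nonneg)
  moreover have "hnorm N * hnorm w' = hnorm N * hnorm w - (norm \<langle>w, N\<rangle>)\<^sup>2"
    using nw' N(2) by (simp add: field_simps)
  ultimately show "hnorm N * hnorm w \<le> (norm \<langle>w, N\<rangle>)\<^sup>2" by simp
  assume "hnorm N * hnorm w = (norm \<langle>w, N\<rangle>)\<^sup>2"
  with nw' N(2) have "hnorm w' = 0" by (simp add: field_simps)
  then obtain t where t: "w' = N \<cdot>\<^sub>r t"
    using orthogonal_semidefinite(2)[OF N(1) N0 _ w' orth] N(2) by auto
  with orth N have "\<langle>N, N\<rangle> * t = 0" by (simp add: herm_simps)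
  then have "t = 0" using N(2) by auto
  with t N have "w - N \<cdot>\<^sub>r s = 0\<^sub>v (n + 1)" by (simp add: w'_def) (auto simp: vec_rscale_def)
  then have "\<forall>i<n+1. (w - N \<cdot>\<^sub>r s) $ i = 0" by simp
  then show "w = N \<cdot>\<^sub>r (of_real (inverse (hnorm N)) * \<langle>w, N\<rangle>)"
    using N w by (intro eq_vecI) (auto simp: s_def)
qed

text \<open>
  The lifts of the points of the closed ball.
\<close>

definition nonpos :: "quat vec set" where
  "nonpos = {z \<in> space. z \<noteq> 0\<^sub>v (n + 1) \<and> hnorm z \<le> 0}"

lemma nonposD: "z \<in> nonpos \<Longrightarrow> z \<in> space" "z \<in> nonpos \<Longrightarrow> z \<noteq> 0\<^sub>v (n + 1)"
  "z \<in> nonpos \<Longrightarrow> hnorm z \<le> 0"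
  by (auto simp: nonpos_def)

text \<open>
  The plane spanned by two distinct points of the closed ball is nondegenerate of signature (1,1).
\<close>

lemma gram_determinant_neg:
  assumes z: "z \<in> nonpos" and w: "w \<in> nonpos" and ne: "\<And>s. w \<noteq> z \<cdot>\<^sub>r s"
  shows "hnorm z * hnorm w < (norm \<langle>w, z\<rangle>)\<^sup>2"
proof (cases "hnorm z = 0")
  case True
  have "\<langle>w, z\<rangle> \<noteq> 0"
    using orthogonal_semidefinite[of z w] nonposD[OF z] nonposD[OF w] ne by force
  with True show ?thesis by simp
next
  case False
  with reverse_Cauchy_Schwarz[of z w] nonposD[OF z] nonposD[OF w] ne show ?thesis by force
qed

lemma herm_nonzero:
  assumes "z \<in> nonpos" "w \<in> nonpos" "\<And>s. w \<noteq> z \<cdot>\<^sub>r s"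
  shows "\<langle>w, z\<rangle> \<noteq> 0" "\<langle>z, w\<rangle> \<noteq> 0"
proof -
  have "0 \<le> hnorm z * hnorm w" using assms nonposD(3) by (simp add: mult_nonpos_nonpos)
  with gram_determinant_neg[OF assms] show "\<langle>w, z\<rangle> \<noteq> 0" by auto
  then show "\<langle>z, w\<rangle> \<noteq> 0" using cnj_herm[of z w] assms(1,2)[THEN nonposD(1)] by auto
qed

section \<open>Isometries and Witt's theorem\<close>

lemma herm_mat_mult:
  assumes "g \<in> carrier_mat (n + 1) (n + 1)" "z \<in> space" "w \<in> space"
  shows "\<langle>g *\<^sub>v z, g *\<^sub>v w\<rangle> = map_vec qcnj w \<bullet> ((adjoint_mat g * Jmat n * g) *\<^sub>v z)"
proof -
  have a: "adjoint_mat g \<in> carrier_mat (n + 1) (n + 1)" using assms by simp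
  have "(adjoint_mat g * Jmat n * g) *\<^sub>v z = adjoint_mat g *\<^sub>v (Jmat n *\<^sub>v (g *\<^sub>v z))"
    using assoc_mult_mat_vec[OF mult_carrier_mat[OF a Jmat_carrier] assms(1,2)]
      assoc_mult_mat_vec[OF a Jmat_carrier mult_mat_vec_carrier[OF assms(1,2)]] by simp
  moreover have "Jmat n *\<^sub>v (g *\<^sub>v z) \<in> space"
    by (intro mult_mat_vec_carrier[OF Jmat_carrier] mult_mat_vec_carrier[OF assms(1,2)])
  ultimately show ?thesis
    unfolding herm_def using cnj_scalar_prod_adjoint[OF assms(1,3)] by simp
qed

lemma Sp_preserves_herm:
  assumes "g \<in> Sp n" "z \<in> space" "w \<in> space"
  shows "\<langle>g *\<^sub>v z, g *\<^sub>v w\<rangle> = \<langle>z, w\<rangle>"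
  using assms herm_mat_mult[of g z w] by (simp add: Sp_def herm_def)

text \<open>
  Invariance of the form provides a left inverse of \<open>g\<close>; over the quaternions it takes a dimension argument
  to see that this is a right inverse. The isometries below come with explicit inverses.
\<close>

lemma SpI:
  assumes g: "g \<in> carrier_mat (n + 1) (n + 1)" and g': "g' \<in> carrier_mat (n + 1) (n + 1)"
    and inv: "\<And>z. z \<in> space \<Longrightarrow> g *\<^sub>v (g' *\<^sub>v z) = z" "\<And>z. z \<in> space \<Longrightarrow> g' *\<^sub>v (g *\<^sub>v z) = z"
    and iso: "\<And>z w. z \<in> space \<Longrightarrow> w \<in> space \<Longrightarrow> \<langle>g *\<^sub>v z, g *\<^sub>v w\<rangle> = \<langle>z, w\<rangle>"
  shows "g \<in> Sp n"
proof -
  have "g * g' = 1\<^sub>m (n + 1)" "g' * g = 1\<^sub>m (n + 1)"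
    by (rule mat_eq_if_action_eq[of _ "n + 1" "n + 1"]; use g g' inv in simp)+
  then have "invertible_mat g"
    using g g' unfolding invertible_mat_def inverts_mat_def square_mat.simps by auto
  moreover have "adjoint_mat g * Jmat n * g = Jmat n"
  proof (rule eq_matI)
    fix i j assume "i < dim_row (Jmat n)" "j < dim_col (Jmat n)"
    then have ij: "i < n + 1" "j < n + 1" using Jmat_carrier[of n] by auto
    have unit: "map_vec qcnj (unit_vec (n + 1) i) = unit_vec (n + 1) i"
      by (rule eq_vecI) (auto simp: unit_vec_def)
    have entry: "unit_vec (n + 1) i \<bullet> (A *\<^sub>v unit_vec (n + 1) j) = A $$ (i, j)"
      if "A \<in> carrier_mat (n + 1) (n + 1)" for A :: "quat mat"
      using that ij by (simp add: scalar_prod_left_unit)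
    have "adjoint_mat g * Jmat n * g \<in> carrier_mat (n + 1) (n + 1)"
      by (rule mult_carrier_mat[OF mult_carrier_mat[OF adjoint_mat_carrier[OF g] Jmat_carrier] g])
    from entry[OF this] entry[OF Jmat_carrier] show "(adjoint_mat g * Jmat n * g) $$ (i, j) = Jmat n $$ (i, j)"
      using herm_mat_mult[OF g, of "unit_vec (n + 1) j" "unit_vec (n + 1) i"]
        iso[of "unit_vec (n + 1) j" "unit_vec (n + 1) i"]
      unfolding unit herm_def by (simp only: unit_vec_carrier)
  qed (use g in \<open>auto simp: adjoint_mat_def Jmat_def\<close>)
  ultimately show ?thesis using g by (simp add: Sp_def)
qed

lemma one_in_Sp: "1\<^sub>m (n + 1) \<in> Sp n"
  by (rule SpI[of _ "1\<^sub>m (n + 1)"]) simp_all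

lemma Sp_carrier: "g \<in> Sp n \<Longrightarrow> g \<in> carrier_mat (n + 1) (n + 1)"
  by (simp add: Sp_def)

lemma Sp_apply_carrier: "g \<in> Sp n \<Longrightarrow> z \<in> space \<Longrightarrow> g *\<^sub>v z \<in> space"
  by (rule mult_mat_vec_carrier[OF Sp_carrier])

lemma Sp_inverse:
  assumes "g \<in> Sp n"
  obtains g' where "g' \<in> carrier_mat (n + 1) (n + 1)"
    "\<And>z. z \<in> space \<Longrightarrow> g *\<^sub>v (g' *\<^sub>v z) = z" "\<And>z. z \<in> space \<Longrightarrow> g' *\<^sub>v (g *\<^sub>v z) = z"
proof -
  have g: "g \<in> carrier_mat (n + 1) (n + 1)" "invertible_mat g" using assms by (auto simp: Sp_def)
  then obtain g' where g': "g * g' = 1\<^sub>m (n + 1)" "g' * g = 1\<^sub>m (dim_row g')"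
    unfolding invertible_mat_def inverts_mat_def by auto
  have "dim_col (g * g') = dim_col (1\<^sub>m (n + 1) :: quat mat)"
    "dim_col (g' * g) = dim_col (1\<^sub>m (dim_row g') :: quat mat)" using g' by simp_all
  then have c: "g' \<in> carrier_mat (n + 1) (n + 1)" using g(1) by auto
  show thesis
    by (rule that[OF c]) (use g g' c in \<open>simp_all flip: assoc_mult_mat_vec\<close>)
qed

lemma Sp_mult:
  assumes "g \<in> Sp n" "h \<in> Sp n"
  shows "g * h \<in> Sp n"
proof -
  obtain g' where g': "g' \<in> carrier_mat (n + 1) (n + 1)"
    "\<And>z. z \<in> space \<Longrightarrow> g *\<^sub>v (g' *\<^sub>v z) = z" "\<And>z. z \<in> space \<Longrightarrow> g' *\<^sub>v (g *\<^sub>v z) = z"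
    by (rule Sp_inverse[OF assms(1)]) (rule that)
  obtain h' where h': "h' \<in> carrier_mat (n + 1) (n + 1)"
    "\<And>z. z \<in> space \<Longrightarrow> h *\<^sub>v (h' *\<^sub>v z) = z" "\<And>z. z \<in> space \<Longrightarrow> h' *\<^sub>v (h *\<^sub>v z) = z"
    by (rule Sp_inverse[OF assms(2)]) (rule that)
  note gh = assms[THEN Sp_carrier]
  have app: "(g * h) *\<^sub>v z = g *\<^sub>v (h *\<^sub>v z)" "(h' * g') *\<^sub>v z = h' *\<^sub>v (g' *\<^sub>v z)" if "z \<in> space" for z
    using assoc_mult_mat_vec[OF gh that] assoc_mult_mat_vec[OF h'(1) g'(1) that] .
  have car: "h *\<^sub>v z \<in> space" "g' *\<^sub>v z \<in> space" if "z \<in> space" for z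
    using mult_mat_vec_carrier[OF gh(2) that] mult_mat_vec_carrier[OF g'(1) that] .
  have car2: "h' *\<^sub>v (g' *\<^sub>v z) \<in> space" "g *\<^sub>v (h *\<^sub>v z) \<in> space" if "z \<in> space" for z
    using mult_mat_vec_carrier[OF h'(1) car(2)[OF that]] mult_mat_vec_carrier[OF gh(1) car(1)[OF that]] .
  show ?thesis
  proof (rule SpI[OF mult_carrier_mat[OF gh] mult_carrier_mat[OF h'(1) g'(1)]])
    fix z assume z: "z \<in> space"
    show "(g * h) *\<^sub>v ((h' * g') *\<^sub>v z) = z"
      by (simp only: app z car car2 g' h')
    show "(h' * g') *\<^sub>v ((g * h) *\<^sub>v z) = z"
      by (simp only: app z car car2 g' h')
    fix w assume w: "w \<in> space"
    show "\<langle>(g * h) *\<^sub>v z, (g * h) *\<^sub>v w\<rangle> = \<langle>z, w\<rangle>"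
      by (simp only: app z w car Sp_preserves_herm assms)
  qed
qed

text \<open>
  The matrix of the quasi-reflection \<open>z \<mapsto> z - u c \<langle>z, u\<rangle>\<close>.
\<close>

definition reflection :: "quat vec \<Rightarrow> quat \<Rightarrow> quat mat" where
  "reflection u c = mat (n + 1) (n + 1) (\<lambda>(i, j).
     (if i = j then 1 else 0) - u $ i * c * (\<Sum>k\<in>{0..<n + 1}. qcnj (u $ k) * Jmat n $$ (k, j)))"

lemma reflection_carrier: "reflection u c \<in> carrier_mat (n + 1) (n + 1)"
  by (simp add: reflection_def)

lemma reflection_apply:
  assumes u: "u \<in> space" and z: "z \<in> space"
  shows "reflection u c *\<^sub>v z = z - u \<cdot>\<^sub>r (c * \<langle>z, u\<rangle>)"
proof (rule eq_vecI)
  fix i assume "i < dim_vec (z - u \<cdot>\<^sub>r (c * \<langle>z, u\<rangle>))"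
  then have i: "i < n + 1" using u by simp
  let ?I = "{0..<n + 1}"
  have "(Jmat n *\<^sub>v z) $ k = (\<Sum>j\<in>?I. Jmat n $$ (k, j) * z $ j)" if "k \<in> ?I" for k
    using z that carrier_matD[OF Jmat_carrier[of n]]
    by (simp add: scalar_prod_def del: sum.op_ivl_Suc)
  then have "\<langle>z, u\<rangle> = (\<Sum>k\<in>?I. qcnj (u $ k) * (\<Sum>j\<in>?I. Jmat n $$ (k, j) * z $ j))"
    using u carrier_matD[OF Jmat_carrier[of n]]
    by (simp add: herm_def scalar_prod_def del: sum.op_ivl_Suc)
  also have "\<dots> = (\<Sum>k\<in>?I. \<Sum>j\<in>?I. qcnj (u $ k) * Jmat n $$ (k, j) * z $ j)"
    by (simp only: sum_distrib_left mult.assoc)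
  also have "\<dots> = (\<Sum>j\<in>?I. \<Sum>k\<in>?I. qcnj (u $ k) * Jmat n $$ (k, j) * z $ j)"
    by (rule sum.swap)
  finally have form: "\<langle>z, u\<rangle> = (\<Sum>j\<in>?I. (\<Sum>k\<in>?I. qcnj (u $ k) * Jmat n $$ (k, j)) * z $ j)"
    by (simp only: sum_distrib_right)
  define r where "r j = (\<Sum>k\<in>?I. qcnj (u $ k) * Jmat n $$ (k, j))" for j
  have "(reflection u c *\<^sub>v z) $ i
      = (\<Sum>j\<in>?I. ((if i = j then 1 else 0) - u $ i * c * r j) * z $ j)"
    using z i by (simp add: reflection_def r_def scalar_prod_def del: sum.op_ivl_Suc)
  also have "\<dots> = (\<Sum>j\<in>?I. (if i = j then z $ j else 0) - u $ i * c * (r j * z $ j))"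
    by (intro sum.cong) (auto simp: left_diff_distrib mult.assoc)
  also have "\<dots> = (\<Sum>j\<in>?I. if i = j then z $ j else 0) - u $ i * c * (\<Sum>j\<in>?I. r j * z $ j)"
    by (simp only: sum_subtractf sum_distrib_left)
  also have "\<dots> = z $ i - u $ i * c * \<langle>z, u\<rangle>"
    using i unfolding form r_def by (simp del: sum.op_ivl_Suc)
  finally show "(reflection u c *\<^sub>v z) $ i = (z - u \<cdot>\<^sub>r (c * \<langle>z, u\<rangle>)) $ i"
    using u z i by (simp add: mult.assoc)
qed (use u z in \<open>simp add: reflection_def\<close>)

text \<open>
  Expanding \<open>\<langle>z - u c \<langle>z, u\<rangle>, w - u c \<langle>w, u\<rangle>\<rangle>\<close> leaves \<open>\<langle>u, w\<rangle> (cnj c \<langle>u, u\<rangle> c - c - cnj c) \<langle>z, u\<rangle>\<close> besides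
  \<open>\<langle>z, w\<rangle>\<close>. Under the hypothesis this vanishes, and \<open>reflection u (cnj c)\<close> is the inverse.
\<close>

lemma reflection_in_Sp:
  assumes u: "u \<in> space" and c: "c + qcnj c = of_real ((norm c)\<^sup>2 * hnorm u)"
  shows "reflection u c \<in> Sp n"
proof (rule SpI[OF reflection_carrier reflection_carrier])
  have comm: "a * of_real (hnorm u) * b = of_real (hnorm u) * (a * b)" for a b :: quat
    by (simp only: of_real_mult_commute[of a] mult.assoc)
  have inv: "reflection u a *\<^sub>v (reflection u b *\<^sub>v z) = z"
    if z: "z \<in> space" and ab: "a + b = a * of_real (hnorm u) * b" for z a b
  proof -
    let ?h = "\<langle>z, u\<rangle>"
    have "reflection u a *\<^sub>v (reflection u b *\<^sub>v z)
        = z - u \<cdot>\<^sub>r (b * ?h) - u \<cdot>\<^sub>r (a * (?h - \<langle>u, u\<rangle> * (b * ?h)))"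
      using u z by (simp add: reflection_apply herm_simps)
    also have "\<dots> = z - u \<cdot>\<^sub>r ((a + b - a * of_real (hnorm u) * b) * ?h)"
      using u z by (intro eq_vecI) (auto simp: algebra_simps herm_self[OF u, symmetric])
    also have "\<dots> = z" using ab u z by (intro eq_vecI) auto
    finally show ?thesis .
  qed
  have id1: "c + qcnj c = c * of_real (hnorm u) * qcnj c"
    unfolding comm c mult_qcnj by (simp add: mult.commute)
  have id2: "qcnj c + c = qcnj c * of_real (hnorm u) * c"
    unfolding comm qcnj_mult_self using c by (simp add: mult.commute add.commute)
  fix z assume z: "z \<in> space"
  show "reflection u c *\<^sub>v (reflection u (qcnj c) *\<^sub>v z) = z" by (rule inv[OF z id1])
  show "reflection u (qcnj c) *\<^sub>v (reflection u c *\<^sub>v z) = z" by (rule inv[OF z id2])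
  fix w assume w: "w \<in> space"
  let ?a = "\<langle>u, w\<rangle>" and ?b = "\<langle>z, u\<rangle>"
  have "\<langle>reflection u c *\<^sub>v z, reflection u c *\<^sub>v w\<rangle>
      = \<langle>z, w\<rangle> - ?a * (c + qcnj c - qcnj c * of_real (hnorm u) * c) * ?b"
    using u z w cnj_herm[OF w u]
    by (simp add: reflection_apply herm_simps herm_self[OF u, symmetric] qcnj_mult algebra_simps)
  then show "\<langle>reflection u c *\<^sub>v z, reflection u c *\<^sub>v w\<rangle> = \<langle>z, w\<rangle>"
    using id2 by (simp add: add.commute)
qed

text \<open>
  The quasi-reflection along \<open>u = x - y\<close> with \<open>c = \<langle>x, u\<rangle>\<^sup>-\<^sup>1\<close> sends \<open>x\<close> to \<open>x - u = y\<close>. It is an isometry because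
  \<open>2 Re \<langle>x, u\<rangle> = \<langle>u, u\<rangle>\<close> for vectors of equal norm.
\<close>

lemma isometry_between:
  assumes x: "x \<in> space" and y: "y \<in> space" and eq: "hnorm x = hnorm y"
    and ne: "x \<noteq> y \<Longrightarrow> \<langle>x, x - y\<rangle> \<noteq> 0"
  obtains g where "g \<in> Sp n" "g *\<^sub>v x = y"
    "\<And>z. z \<in> space \<Longrightarrow> \<langle>z, x\<rangle> = \<langle>z, y\<rangle> \<Longrightarrow> g *\<^sub>v z = z"
proof (cases "x = y")
  case True
  with that[OF one_in_Sp] x show thesis by simp
next
  case False
  define u c where "u = x - y" and "c = inverse \<langle>x, u\<rangle>"
  have u: "u \<in> space" using x y by (simp add: u_def)
  have k: "\<langle>x, u\<rangle> \<noteq> 0" using ne[OF False] by (simp add: u_def)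
  have "qRe \<langle>x, y\<rangle> = qRe \<langle>y, x\<rangle>" using cnj_herm[OF x y] by (metis qcnj.sel(1))
  then have nu: "hnorm u = 2 * qRe \<langle>x, u\<rangle>"
    using x y eq by (simp add: u_def herm_simps)
  let ?k = "\<langle>x, u\<rangle>"
  have ci: "c = of_real (inverse ((norm ?k)\<^sup>2)) * qcnj ?k"
  proof -
    have "of_real (inverse ((norm ?k)\<^sup>2)) * qcnj ?k * ?k = 1"
      using k by (simp only: mult.assoc qcnj_mult_self of_real_mult[symmetric]) simp
    then show ?thesis unfolding c_def by (metis inverse_unique k left_inverse mult.assoc mult_1_right right_inverse)
  qed
  have "c + qcnj c = of_real (inverse ((norm ?k)\<^sup>2)) * (?k + qcnj ?k)"
    unfolding ci by (simp only: qcnj_mult qcnj_of_real qcnj_qcnj of_real_mult_commute distrib_left add.commute)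
  also have "?k + qcnj ?k = of_real (hnorm u)"
    unfolding nu by (simp add: quat_eq_iff of_real_def)
  also have "of_real (inverse ((norm ?k)\<^sup>2)) * of_real (hnorm u) = of_real ((norm c)\<^sup>2 * hnorm u)"
    by (simp add: c_def norm_inverse power_inverse)
  finally have "reflection u c \<in> Sp n" by (rule reflection_in_Sp[OF u])
  then show thesis
  proof (rule that)
    have "c * \<langle>x, u\<rangle> = 1" using k by (simp add: c_def)
    then have "reflection u c *\<^sub>v x = x - u"
      by (simp only: reflection_apply u x rscale_1)
    also have "x - u = y" using x y by (intro eq_vecI) (auto simp: u_def)
    finally show "reflection u c *\<^sub>v x = y" .
    fix z assume z: "z \<in> space" and "\<langle>z, x\<rangle> = \<langle>z, y\<rangle>"
    then have "\<langle>z, u\<rangle> = 0" using x y by (simp add: u_def herm_simps)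
    then show "reflection u c *\<^sub>v z = z"
      using z u by (intro eq_vecI) (auto simp: reflection_apply)
  qed
qed

text \<open>
  The vectors are moved into place one after the other. The first step uses the equality case of the
  reverse Cauchy-Schwarz inequality. At a later step, \<open>x - y\<close> is orthogonal to the vectors already in place,
  in particular to the negative vector \<open>R 0\<close>, so that \<open>2 Re \<langle>x, x - y\<rangle> = \<langle>x - y, x - y\<rangle>\<close> can only vanish for \<open>x = y\<close>.
\<close>

lemma Witt_extension:
  fixes P R :: "nat \<Rightarrow> quat vec"
  assumes neg: "hnorm (P 0) < 0"
    and car: "\<And>i. i \<le> k \<Longrightarrow> P i \<in> space" "\<And>i. i \<le> k \<Longrightarrow> R i \<in> space"
    and gram: "\<And>i j. i \<le> k \<Longrightarrow> j \<le> k \<Longrightarrow> \<langle>P i, P j\<rangle> = \<langle>R i, R j\<rangle>"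
  shows "\<exists>g\<in>Sp n. \<forall>i\<le>k. g *\<^sub>v P i = R i"
  using car gram
proof (induction k)
  case 0
  let ?x = "P 0" and ?y = "R 0"
  have x: "?x \<in> space" and y: "?y \<in> space" and e: "hnorm ?x = hnorm ?y"
    using 0 by auto
  have "\<langle>?x, ?x - ?y\<rangle> \<noteq> 0" if "?x \<noteq> ?y"
  proof
    assume "\<langle>?x, ?x - ?y\<rangle> = 0"
    then have "\<langle>?x, ?y\<rangle> = \<langle>?x, ?x\<rangle>" using x y by (simp add: herm_simps)
    then have yx: "\<langle>?y, ?x\<rangle> = of_real (hnorm ?x)"
      by (metis cnj_herm herm_self x y qcnj_of_real)
    have "?y = ?x \<cdot>\<^sub>r (of_real (inverse (hnorm ?x)) * \<langle>?y, ?x\<rangle>)"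
      by (rule reverse_Cauchy_Schwarz(2)[OF x neg y]) (simp add: yx e power2_eq_square)
    also have "\<dots> = ?x" using neg unfolding yx of_real_mult[symmetric] by simp
    finally show False using that by simp
  qed
  from isometry_between[OF x y e this] show ?case by blast
next
  case (Suc k)
  then obtain g where g: "g \<in> Sp n" "\<forall>i\<le>k. g *\<^sub>v P i = R i" by force
  define x y where "x = g *\<^sub>v P (Suc k)" and "y = R (Suc k)"
  have x: "x \<in> space" and y: "y \<in> space"
    unfolding x_def y_def by (rule Sp_apply_carrier[OF g(1)]; use Suc.prems in simp) (use Suc.prems in simp)
  have e: "\<langle>x, x\<rangle> = \<langle>y, y\<rangle>"
    using Suc.prems g(1) by (simp add: x_def y_def Sp_preserves_herm)
  have orth: "\<langle>R i, x\<rangle> = \<langle>R i, y\<rangle>" if "i \<le> k" for i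
  proof -
    have "\<langle>R i, x\<rangle> = \<langle>g *\<^sub>v P i, g *\<^sub>v P (Suc k)\<rangle>" using g that by (simp add: x_def)
    also have "\<dots> = \<langle>R i, y\<rangle>"
      using Suc.prems g(1) that by (subst Sp_preserves_herm) (auto simp: y_def)
    finally show ?thesis .
  qed
  have R0: "R 0 \<in> space" "hnorm (R 0) < 0" using Suc.prems neg by (auto simp flip: Suc.prems(3))
  have "\<langle>x, x - y\<rangle> \<noteq> 0" if "x \<noteq> y"
  proof
    let ?u = "x - y"
    assume "\<langle>x, x - y\<rangle> = 0"
    then have xy: "\<langle>x, y\<rangle> = \<langle>x, x\<rangle>" using x y by (simp add: herm_simps)
    then have "\<langle>y, x\<rangle> = \<langle>x, x\<rangle>" by (metis cnj_herm x y)
    with xy e x y have u0: "hnorm ?u = 0" by (simp add: herm_simps)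
    have u: "?u \<in> space" using x y by simp
    have "\<langle>R 0, ?u\<rangle> = 0" using orth[of 0] R0 x y by (simp add: herm_simps)
    then have Ru: "\<langle>?u, R 0\<rangle> = 0" using cnj_herm[OF R0(1) u] by simp
    have "?u = R 0 \<cdot>\<^sub>r (of_real (inverse (hnorm (R 0))) * \<langle>?u, R 0\<rangle>)"
      by (rule reverse_Cauchy_Schwarz(2)[OF R0 u]) (simp add: u0 Ru)
    then have "\<forall>i<n+1. (x - y) $ i = 0" using R0 Ru by simp
    then have "x = y" using x y by (intro eq_vecI) auto
    with that show False ..
  qed
  from isometry_between[OF x y _ this] e obtain h where h: "h \<in> Sp n" "h *\<^sub>v x = y"
    "\<And>z. z \<in> space \<Longrightarrow> \<langle>z, x\<rangle> = \<langle>z, y\<rangle> \<Longrightarrow> h *\<^sub>v z = z" by metis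
  have "(h * g) *\<^sub>v P i = R i" if "i \<le> Suc k" for i
  proof -
    have "(h * g) *\<^sub>v P i = h *\<^sub>v (g *\<^sub>v P i)"
      by (intro assoc_mult_mat_vec[OF Sp_carrier[OF h(1)] Sp_carrier[OF g(1)]] Suc.prems that)
    also have "\<dots> = R i"
      using that h g orth Suc.prems by (cases "i = Suc k") (auto simp: x_def y_def)
    finally show ?thesis .
  qed
  with Sp_mult[OF h(1) g(1)] show ?case by blast
qed

section \<open>Congruence of triples of lifts\<close>

text \<open>
  Witt's theorem needs a negative vector to start from; none of the \<open>z\<^sub>i\<close> has to be one. But
  \<open>N = z\<^sub>1 + z\<^sub>2 l\<close> with \<open>\<langle>z\<^sub>2, z\<^sub>1\<rangle> l = -1\<close> has norm at most \<open>-2\<close>, and it can be mapped to the same combination of the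
  \<open>y\<^sub>i\<close>.
\<close>

lemma isometry_if_gram_eq:
  assumes z: "z1 \<in> nonpos" "z2 \<in> nonpos" "z3 \<in> space" and ne: "\<And>s. z2 \<noteq> z1 \<cdot>\<^sub>r s"
    and y: "y1 \<in> space" "y2 \<in> space" "y3 \<in> space"
    and diag: "\<langle>z1, z1\<rangle> = \<langle>y1, y1\<rangle>" "\<langle>z2, z2\<rangle> = \<langle>y2, y2\<rangle>" "\<langle>z3, z3\<rangle> = \<langle>y3, y3\<rangle>"
    and off: "\<langle>z2, z1\<rangle> = \<langle>y2, y1\<rangle>" "\<langle>z3, z2\<rangle> = \<langle>y3, y2\<rangle>" "\<langle>z1, z3\<rangle> = \<langle>y1, y3\<rangle>"
  shows "\<exists>h\<in>Sp n. h *\<^sub>v z1 = y1 \<and> h *\<^sub>v z2 = y2 \<and> h *\<^sub>v z3 = y3"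
proof -
  have zs: "z1 \<in> space" "z2 \<in> space" using z nonposD by auto
  have off': "\<langle>z1, z2\<rangle> = \<langle>y1, y2\<rangle>" "\<langle>z2, z3\<rangle> = \<langle>y2, y3\<rangle>" "\<langle>z3, z1\<rangle> = \<langle>y3, y1\<rangle>"
    using off zs z(3) y by (metis cnj_herm)+
  define l where "l = - inverse \<langle>z2, z1\<rangle>"
  have k: "\<langle>z2, z1\<rangle> * l = -1" using herm_nonzero[OF z(1,2) ne] by (simp add: l_def)
  have k': "qcnj l * \<langle>z1, z2\<rangle> = -1"
    using arg_cong[OF k, of qcnj] zs by (simp add: qcnj_mult cnj_herm)
  define N where "N z w = z + w \<cdot>\<^sub>r l" for z w
  have "\<langle>N z1 z2, N z1 z2\<rangle> = \<langle>z1, z1\<rangle> + \<langle>z2, z1\<rangle> * l + (qcnj l * \<langle>z1, z2\<rangle> + qcnj l * \<langle>z2, z2\<rangle> * l)"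
    using zs by (simp add: N_def herm_simps algebra_simps)
  then have "hnorm (N z1 z2) = hnorm z1 + (norm l)\<^sup>2 * hnorm z2 - 2"
    unfolding k k' by (simp add: qRe_conjugate)
  moreover have "(norm l)\<^sup>2 * hnorm z2 \<le> 0" "hnorm z1 \<le> 0"
    using z nonposD(3) by (simp_all add: mult_nonneg_nonpos)
  ultimately have neg: "hnorm (N z1 z2) < 0" by linarith
  let ?P = "\<lambda>i. [N z1 z2, z1, z2, z3] ! i" and ?R = "\<lambda>i. [N y1 y2, y1, y2, y3] ! i"
  have le3: "i = 0 \<or> i = 1 \<or> i = 2 \<or> i = 3" if "i \<le> 3" for i :: nat using that by linarith
  have "\<exists>g\<in>Sp n. \<forall>i\<le>3. g *\<^sub>v ?P i = ?R i"
  proof (rule Witt_extension)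
    show "hnorm (?P 0) < 0" using neg by simp
    show "?P i \<in> space" "?R i \<in> space" if "i \<le> 3" for i
      using le3[OF that] zs z y by (auto simp: N_def)
    show "\<langle>?P i, ?P j\<rangle> = \<langle>?R i, ?R j\<rangle>" if "i \<le> 3" "j \<le> 3" for i j
      using le3[OF that(1)] le3[OF that(2)] zs z(3) y
      by (elim disjE) (simp_all add: N_def herm_simps diag off off')
  qed
  then obtain g where "g \<in> Sp n" and g: "\<forall>i\<le>3. g *\<^sub>v ?P i = ?R i" by blast
  from g[rule_format, of 1] g[rule_format, of 2] g[rule_format, of 3] \<open>g \<in> Sp n\<close>
  show ?thesis by auto
qed

text \<open>
  Rescaling conjugates the triple product by \<open>a\<close>, up to a positive real factor.
\<close>

lemma qRe_herm3_rscale: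
  assumes "z1 \<in> space" "z2 \<in> space" "z3 \<in> space"
  shows "qRe (herm3 n (z1 \<cdot>\<^sub>r a) (z2 \<cdot>\<^sub>r b) (z3 \<cdot>\<^sub>r c)) =
    (norm a * norm b * norm c)\<^sup>2 * qRe (herm3 n z1 z2 z3)"
proof -
  let ?t = "herm3 n z1 z2 z3"
  have "herm3 n (z1 \<cdot>\<^sub>r a) (z2 \<cdot>\<^sub>r b) (z3 \<cdot>\<^sub>r c)
      = qcnj a * (\<langle>z2, z1\<rangle> * (b * qcnj b) * \<langle>z3, z2\<rangle> * (c * qcnj c) * \<langle>z1, z3\<rangle>) * a"
    using assms n by (simp add: herm3_def herm_rscale mult.assoc)
  also have "\<dots> = of_real ((norm b * norm c)\<^sup>2) * (qcnj a * ?t * a)"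
    unfolding mult_qcnj herm3_def of_real_def by (simp add: mult.assoc power2_eq_square ac_simps)
  finally show ?thesis
    by (simp only: qRe_scaled qRe_conjugate power_mult_distrib) (simp add: ac_simps)
qed

text \<open>
  Congruence of triples of lifts up to scalars, expressed by real numbers: the scalars are found
  in \<open>matching_scalars_exist\<close>, the isometry in \<open>isometry_if_gram_eq\<close>.
\<close>

lemma congruent_iff_moduli_similar:
  assumes z: "z1 \<in> nonpos" "z2 \<in> nonpos" "z3 \<in> nonpos"
    and y: "y1 \<in> nonpos" "y2 \<in> nonpos" "y3 \<in> nonpos"
    and zne: "\<And>s. z2 \<noteq> z1 \<cdot>\<^sub>r s"
    and yne: "\<And>s. y2 \<noteq> y1 \<cdot>\<^sub>r s" "\<And>s. y3 \<noteq> y2 \<cdot>\<^sub>r s" "\<And>s. y3 \<noteq> y1 \<cdot>\<^sub>r s"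
  shows "(\<exists>h\<in>Sp n. (\<exists>a. a \<noteq> 0 \<and> h *\<^sub>v z1 = y1 \<cdot>\<^sub>r a) \<and> (\<exists>b. b \<noteq> 0 \<and> h *\<^sub>v z2 = y2 \<cdot>\<^sub>r b) \<and>
      (\<exists>c. c \<noteq> 0 \<and> h *\<^sub>v z3 = y3 \<cdot>\<^sub>r c)) \<longleftrightarrow>
    moduli_similar (hnorm z1) (hnorm z2) (hnorm z3)
      (norm \<langle>z2, z1\<rangle>) (norm \<langle>z3, z2\<rangle>) (norm \<langle>z1, z3\<rangle>) (qRe (herm3 n z1 z2 z3))
      (hnorm y1) (hnorm y2) (hnorm y3)
      (norm \<langle>y2, y1\<rangle>) (norm \<langle>y3, y2\<rangle>) (norm \<langle>y1, y3\<rangle>) (qRe (herm3 n y1 y2 y3))"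
    (is "?L \<longleftrightarrow> ?R")
proof
  note zs = z[THEN nonposD(1)] and ys = y[THEN nonposD(1)]
  assume ?L
  then obtain h a b c where h: "h \<in> Sp n" "a \<noteq> 0" "b \<noteq> 0" "c \<noteq> 0"
    "h *\<^sub>v z1 = y1 \<cdot>\<^sub>r a" "h *\<^sub>v z2 = y2 \<cdot>\<^sub>r b" "h *\<^sub>v z3 = y3 \<cdot>\<^sub>r c" by blast
  have form: "\<langle>z, w\<rangle> = \<langle>h *\<^sub>v z, h *\<^sub>v w\<rangle>" if "z \<in> space" "w \<in> space" for z w
    using Sp_preserves_herm[OF h(1) that] by simp
  have t: "qRe (herm3 n z1 z2 z3) = (norm a * norm b * norm c)\<^sup>2 * qRe (herm3 n y1 y2 y3)"
    using qRe_herm3_rscale[OF ys, of a b c] zs by (simp only: herm3_def form h)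
  show ?R unfolding moduli_similar_def
    by (rule exI[of _ "norm a"], rule conjI, use h in simp, rule exI[of _ "norm b"], rule conjI,
        use h in simp, rule exI[of _ "norm c"], rule conjI, use h in simp)
      (use t zs ys n in \<open>simp add: form h(5-7) herm_rscale norm_mult qRe_conjugate\<close>)
next
  note zs = z[THEN nonposD(1)] and ys = y[THEN nonposD(1)]
  assume ?R
  then obtain r1 r2 r3 where r: "0 < r1" "0 < r2" "0 < r3"
    and d: "hnorm z1 = r1\<^sup>2 * hnorm y1" "hnorm z2 = r2\<^sup>2 * hnorm y2" "hnorm z3 = r3\<^sup>2 * hnorm y3"
    and o: "norm \<langle>z2, z1\<rangle> = r1 * r2 * norm \<langle>y2, y1\<rangle>" "norm \<langle>z3, z2\<rangle> = r2 * r3 * norm \<langle>y3, y2\<rangle>"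
      "norm \<langle>z1, z3\<rangle> = r1 * r3 * norm \<langle>y1, y3\<rangle>"
      "qRe (\<langle>z2, z1\<rangle> * \<langle>z3, z2\<rangle> * \<langle>z1, z3\<rangle>) = (r1 * r2 * r3)\<^sup>2 * qRe (\<langle>y2, y1\<rangle> * \<langle>y3, y2\<rangle> * \<langle>y1, y3\<rangle>)"
    unfolding moduli_similar_def herm3_def by auto
  have nz: "\<langle>y2, y1\<rangle> \<noteq> 0" "\<langle>y3, y2\<rangle> \<noteq> 0" "\<langle>y1, y3\<rangle> \<noteq> 0"
    using herm_nonzero y yne by blast+
  obtain a b c where abc: "norm a = r1" "norm b = r2" "norm c = r3"
    "qcnj a * \<langle>y2, y1\<rangle> * b = \<langle>z2, z1\<rangle>" "qcnj b * \<langle>y3, y2\<rangle> * c = \<langle>z3, z2\<rangle>"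
    "qcnj c * \<langle>y1, y3\<rangle> * a = \<langle>z1, z3\<rangle>"
    using matching_scalars_exist[OF nz r o] .
  have diag: "\<langle>z, z\<rangle> = \<langle>y \<cdot>\<^sub>r e, y \<cdot>\<^sub>r e\<rangle>"
    if "z \<in> space" "y \<in> space" "norm e = r" "hnorm z = r\<^sup>2 * hnorm y" for z y e r
  proof -
    have "y \<cdot>\<^sub>r e \<in> space" using that by simp
    with that show ?thesis by (metis herm_self hnorm_rscale)
  qed
  have "\<exists>h\<in>Sp n. h *\<^sub>v z1 = y1 \<cdot>\<^sub>r a \<and> h *\<^sub>v z2 = y2 \<cdot>\<^sub>r b \<and> h *\<^sub>v z3 = y3 \<cdot>\<^sub>r c"
  proof (rule isometry_if_gram_eq)
    show "\<langle>z1, z1\<rangle> = \<langle>y1 \<cdot>\<^sub>r a, y1 \<cdot>\<^sub>r a\<rangle>" "\<langle>z2, z2\<rangle> = \<langle>y2 \<cdot>\<^sub>r b, y2 \<cdot>\<^sub>r b\<rangle>" "\<langle>z3, z3\<rangle> = \<langle>y3 \<cdot>\<^sub>r c, y3 \<cdot>\<^sub>r c\<rangle>"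
      using diag[OF zs(1) ys(1) abc(1) d(1)] diag[OF zs(2) ys(2) abc(2) d(2)]
        diag[OF zs(3) ys(3) abc(3) d(3)] .
  qed (use z zs ys zne abc n in \<open>simp_all add: herm_rscale\<close>)
  moreover have "a \<noteq> 0" "b \<noteq> 0" "c \<noteq> 0" using abc r by auto
  ultimately show ?L by blast
qed

section \<open>Distances in terms of lifts\<close>

lemma V_null_V_neg_subset_nonpos: "V_null n \<subseteq> nonpos" "V_neg n \<subseteq> nonpos"
  unfolding V_null_def V_neg_def nonpos_def using herm_0_left by force+

text \<open>
  The sign of the Hermitian norm is the same for all lifts of a point, so it can be read off from the chosen one.
\<close>

lemma clHH_lift:
  assumes "p \<in> clHH n"
  shows "lift p \<in> nonpos" "proj (lift p) = p" "p \<in> HH n \<longleftrightarrow> hnorm (lift p) < 0"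
    "p \<in> bdHH n \<longleftrightarrow> hnorm (lift p) = 0"
proof -
  have sub: "\<exists>z\<in>nonpos. p = proj z"
    using assms V_null_V_neg_subset_nonpos unfolding clHH_def HH_def bdHH_def by auto
  then show pl: "proj (lift p) = p" by (auto simp: proj_lift_proj)
  have lifts: "lift p \<in> space \<and> (\<exists>k>0. hnorm (lift p) = k * hnorm z)" if p: "p = proj z" and z: "z \<in> space" for z
  proof -
    obtain a where a: "a \<noteq> 0" "lift (proj z) = z \<cdot>\<^sub>r a" by (rule lift_proj)
    have "0 < (norm a)\<^sup>2" using a by simp
    with a z p show ?thesis by (auto simp: hnorm_rscale intro!: exI[of _ "(norm a)\<^sup>2"])
  qed
  from sub obtain z where z: "z \<in> nonpos" "p = proj z" by blast
  obtain a where a: "a \<noteq> 0" "lift (proj z) = z \<cdot>\<^sub>r a" by (rule lift_proj)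
  show np: "lift p \<in> nonpos"
    using z lifts[OF z(2) nonposD(1)[OF z(1)]] a
    by (auto simp: nonpos_def rscale_eq_0_iff mult_nonneg_nonpos)
  show "p \<in> HH n \<longleftrightarrow> hnorm (lift p) < 0"
  proof
    assume "p \<in> HH n"
    then obtain z where "p = proj z" "z \<in> space" "hnorm z < 0" by (auto simp: HH_def V_neg_def)
    with lifts[OF this(1,2)] show "hnorm (lift p) < 0" by (auto simp: mult_pos_neg)
  next
    assume "hnorm (lift p) < 0"
    then have "lift p \<in> V_neg n" using nonposD[OF np] by (simp add: V_neg_def)
    with pl show "p \<in> HH n" unfolding HH_def by force
  qed
  show "p \<in> bdHH n \<longleftrightarrow> hnorm (lift p) = 0"
  proof
    assume "p \<in> bdHH n"
    then obtain z where "p = proj z" "z \<in> space" "hnorm z = 0" by (auto simp: bdHH_def V_null_def)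
    with lifts[OF this(1,2)] show "hnorm (lift p) = 0" by auto
  next
    assume h0: "hnorm (lift p) = 0"
    have "\<langle>lift p, lift p\<rangle> = of_real (hnorm (lift p))" by (rule herm_self) (rule nonposD[OF np])
    also have "\<dots> = 0" using h0 by simp
    finally have "lift p \<in> V_null n" using nonposD[OF np] by (simp add: V_null_def)
    with pl show "p \<in> bdHH n" unfolding bdHH_def by force
  qed
qed

lemma lifts_not_proportional:
  assumes "p \<in> clHH n" "q \<in> clHH n" "p \<noteq> q"
  shows "lift q \<noteq> lift p \<cdot>\<^sub>r s"
proof
  assume eq: "lift q = lift p \<cdot>\<^sub>r s"
  have "lift q \<noteq> 0\<^sub>v (n + 1)" "lift p \<in> space"
    using clHH_lift[OF assms(1)] clHH_lift[OF assms(2)] nonposD by auto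
  with eq have "s \<noteq> 0" by (auto simp: rscale_eq_0_iff)
  then have "proj (lift q) = proj (lift p)" by (simp add: eq proj_rscale)
  with clHH_lift(2) assms show False by metis
qed

text \<open>
  This is \<open>cosh\<^sup>2 (\<rho>/2)\<close> in terms of negative lifts.
\<close>

definition cosh_sq :: "quat vec \<Rightarrow> quat vec \<Rightarrow> real" where
  "cosh_sq z w = (norm \<langle>z, w\<rangle>)\<^sup>2 / (hnorm z * hnorm w)"

lemma cosh_sq_ge_1:
  assumes "z \<in> space" "w \<in> space" "hnorm z < 0" "hnorm w < 0"
  shows "1 \<le> cosh_sq z w"
proof -
  have "0 < hnorm w * hnorm z" using assms by (simp add: mult_neg_neg)
  with reverse_Cauchy_Schwarz(1)[OF assms(2,4,1)] show ?thesis
    by (simp add: cosh_sq_def mult.commute)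
qed

lemma cosh_sq_rscale:
  assumes "z \<in> space" "w \<in> space" "a \<noteq> 0"
  shows "cosh_sq (z \<cdot>\<^sub>r a) w = cosh_sq z w"
  using assms n by (simp add: cosh_sq_def herm_simps norm_mult qRe_conjugate power_mult_distrib
      flip: mult.assoc)

text \<open>
  The ratio in the definition of \<open>rho\<close> is a real quaternion, and it is at least 1 by the reverse Cauchy-Schwarz
  inequality; hence the defining equation has exactly one nonnegative solution.
\<close>

lemma rho_eq:
  assumes "p \<in> HH n" "q \<in> HH n"
  shows "rho n p q = 2 * arcosh (sqrt (cosh_sq (lift p) (lift q)))" "1 \<le> cosh_sq (lift p) (lift q)"
proof -
  let ?z = "lift p" and ?w = "lift q"
  have cl: "p \<in> clHH n" "q \<in> clHH n" using assms by (auto simp: clHH_def)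
  have z: "?z \<in> space" "hnorm ?z < 0" and w: "?w \<in> space" "hnorm ?w < 0"
    using clHH_lift[OF cl(1)] clHH_lift[OF cl(2)] nonposD assms by auto
  show ge: "1 \<le> cosh_sq ?z ?w" using cosh_sq_ge_1 z w by blast
  have "\<langle>?z, ?w\<rangle> * \<langle>?w, ?z\<rangle> = of_real ((norm \<langle>?z, ?w\<rangle>)\<^sup>2)"
    using cnj_herm[OF z(1) w(1)] mult_qcnj by metis
  then have "\<langle>?z, ?w\<rangle> * \<langle>?w, ?z\<rangle> / (\<langle>?z, ?z\<rangle> * \<langle>?w, ?w\<rangle>) =
      of_real ((norm \<langle>?z, ?w\<rangle>)\<^sup>2) / (of_real (hnorm ?z) * of_real (hnorm ?w))"
    using herm_self[OF z(1)] herm_self[OF w(1)] by metis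
  also have "\<dots> = of_real (cosh_sq ?z ?w)"
    by (simp add: cosh_sq_def divide_inverse del: of_real_power of_real_inverse
        add: of_real_inverse[symmetric] of_real_mult[symmetric] del: of_real_mult)
  finally have ratio: "\<langle>?z, ?w\<rangle> * \<langle>?w, ?z\<rangle> / (\<langle>?z, ?z\<rangle> * \<langle>?w, ?w\<rangle>) = of_real (cosh_sq ?z ?w)" .
  have s: "1 \<le> sqrt (cosh_sq ?z ?w)" using ge by simp
  show "rho n p q = 2 * arcosh (sqrt (cosh_sq ?z ?w))"
    unfolding rho_def ratio of_real_eq_iff
  proof (rule the_equality)
    show "0 \<le> 2 * arcosh (sqrt (cosh_sq ?z ?w)) \<and>
      (cosh (2 * arcosh (sqrt (cosh_sq ?z ?w)) / 2))\<^sup>2 = cosh_sq ?z ?w"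
      using s ge by simp
    fix r :: real assume r: "0 \<le> r \<and> (cosh (r / 2))\<^sup>2 = cosh_sq ?z ?w"
    then have "sqrt (cosh_sq ?z ?w) = cosh (r / 2)"
      using cosh_real_pos[of "r / 2"] by (metis less_eq_real_def real_sqrt_unique)
    then show "r = 2 * arcosh (sqrt (cosh_sq ?z ?w))" using r by (simp add: arcosh_cosh_real)
  qed
qed

lemma rho_eq_iff:
  assumes "p \<in> HH n" "q \<in> HH n" "p' \<in> HH n" "q' \<in> HH n"
  shows "rho n p q = rho n p' q' \<longleftrightarrow> cosh_sq (lift p) (lift q) = cosh_sq (lift p') (lift q')"
  using rho_eq[OF assms(1,2)] rho_eq[OF assms(3,4)]
  by (metis cosh_arcosh_real mult_cancel_left real_sqrt_eq_iff real_sqrt_ge_1_iff zero_neq_numeral)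

text \<open>
  This is \<open>cosh\<^sup>2 (\<rho>/2)\<close> for the distance from the point of \<open>z\<close> to the line spanned by \<open>u\<close> and \<open>v\<close>; the
  factor on the left of the denominator is the Gram determinant of \<open>u\<close> and \<open>v\<close>.
\<close>

definition line_cosh_sq :: "quat vec \<Rightarrow> quat vec \<Rightarrow> quat vec \<Rightarrow> real" where
  "line_cosh_sq u v z =
     (hnorm v * (norm \<langle>z, u\<rangle>)\<^sup>2 + hnorm u * (norm \<langle>z, v\<rangle>)\<^sup>2 - 2 * qRe (herm3 n u v z)) /
     ((hnorm u * hnorm v - (norm \<langle>v, u\<rangle>)\<^sup>2) * hnorm z)"

text \<open>
  The coefficients of the projection \<open>m\<close> are given by Cramer's rule, which applies because the
  Gram matrix of \<open>u\<close> and \<open>v\<close> is Hermitian with nonzero real determinant. The remainder \<open>z - m\<close> is orthogonal to \<open>u\<close>;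
  therefore it has nonnegative norm, and norm zero only if it is a multiple of \<open>u\<close>.
\<close>

lemma projection_onto_line:
  assumes u: "u \<in> nonpos" and v: "v \<in> nonpos" and ne: "\<And>s. v \<noteq> u \<cdot>\<^sub>r s"
    and z: "z \<in> space" "hnorm z < 0"
  obtains a b where
    "\<langle>z - (u \<cdot>\<^sub>r a + v \<cdot>\<^sub>r b), u\<rangle> = 0" "\<langle>z - (u \<cdot>\<^sub>r a + v \<cdot>\<^sub>r b), v\<rangle> = 0"
    "hnorm (u \<cdot>\<^sub>r a + v \<cdot>\<^sub>r b) = line_cosh_sq u v z * hnorm z"
    "hnorm (u \<cdot>\<^sub>r a + v \<cdot>\<^sub>r b) \<le> hnorm z"
    "line_cosh_sq u v z = 1 \<longrightarrow> (\<exists>s. z = u \<cdot>\<^sub>r s + v \<cdot>\<^sub>r b)"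
proof -
  note us = nonposD(1)[OF u] and vs = nonposD(1)[OF v]
  let ?uu = "hnorm u" and ?vv = "hnorm v" and ?d = "hnorm u * hnorm v - (norm \<langle>v, u\<rangle>)\<^sup>2"
  have d: "?d < 0" using gram_determinant_neg[OF u v ne] by simp
  define a where "a = (1 / ?d) *\<^sub>R (?vv *\<^sub>R \<langle>z, u\<rangle> - \<langle>v, u\<rangle> * \<langle>z, v\<rangle>)"
  define b where "b = (1 / ?d) *\<^sub>R (?uu *\<^sub>R \<langle>z, v\<rangle> - \<langle>u, v\<rangle> * \<langle>z, u\<rangle>)"
  define m where "m = u \<cdot>\<^sub>r a + v \<cdot>\<^sub>r b"
  have m: "m \<in> space" using us vs by (simp add: m_def)
  have uu: "\<langle>u, u\<rangle> * x = ?uu *\<^sub>R x" and vv: "\<langle>v, v\<rangle> * x = ?vv *\<^sub>R x" for x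
    using herm_self[OF us] herm_self[OF vs] by (metis scaleR_conv_of_real)+
  have vu: "\<langle>v, u\<rangle> * (\<langle>u, v\<rangle> * x) = ((norm \<langle>v, u\<rangle>)\<^sup>2) *\<^sub>R x" for x
    using mult_qcnj[of "\<langle>v, u\<rangle>"] cnj_herm[OF vs us]
    by (metis mult.assoc scaleR_conv_of_real)
  have uv: "\<langle>u, v\<rangle> * (\<langle>v, u\<rangle> * x) = ((norm \<langle>v, u\<rangle>)\<^sup>2) *\<^sub>R x" for x
    using qcnj_mult_self[of "\<langle>v, u\<rangle>"] cnj_herm[OF vs us]
    by (metis mult.assoc scaleR_conv_of_real)
  have mu: "\<langle>m, u\<rangle> = \<langle>z, u\<rangle>"
  proof -
    have "\<langle>m, u\<rangle> = (1 / ?d) *\<^sub>R (?d *\<^sub>R \<langle>z, u\<rangle>)"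
      using us vs by (simp add: m_def a_def b_def herm_simps uu vu algebra_simps
          flip: scaleR_right_diff_distrib scaleR_right_distrib)
    then show ?thesis using d by simp
  qed
  have mv: "\<langle>m, v\<rangle> = \<langle>z, v\<rangle>"
  proof -
    have "\<langle>m, v\<rangle> = (1 / ?d) *\<^sub>R (?d *\<^sub>R \<langle>z, v\<rangle>)"
      using us vs by (simp add: m_def a_def b_def herm_simps vv uv algebra_simps
          flip: scaleR_right_diff_distrib scaleR_right_distrib)
    then show ?thesis using d by simp
  qed
  have o: "\<langle>z - m, u\<rangle> = 0" "\<langle>z - m, v\<rangle> = 0"
    using us vs z m by (simp_all add: herm_simps mu mv)
  have om: "\<langle>z - m, m\<rangle> = 0"
    using us vs z m o by (subst (2) m_def) (simp add: herm_simps)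
  have mm: "\<langle>m, m\<rangle> = \<langle>z, m\<rangle>" using om z m by (simp add: herm_simps)
  have "\<langle>m, m\<rangle> = \<langle>m, z\<rangle>" using mm cnj_herm z m by metis
  have diff: "hnorm (z - m) = hnorm z - hnorm m"
    using z m mm \<open>\<langle>m, m\<rangle> = \<langle>m, z\<rangle>\<close> by (simp add: herm_simps)
  have norms: "qRe (\<langle>u, z\<rangle> * \<langle>z, u\<rangle>) = (norm \<langle>z, u\<rangle>)\<^sup>2" "qRe (\<langle>v, z\<rangle> * \<langle>z, v\<rangle>) = (norm \<langle>z, v\<rangle>)\<^sup>2"
    using qcnj_mult_self[of "\<langle>z, u\<rangle>"] qcnj_mult_self[of "\<langle>z, v\<rangle>"] cnj_herm z us vs
    by (metis qRe_of_real)+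
  have t1: "qRe (\<langle>u, z\<rangle> * (\<langle>v, u\<rangle> * \<langle>z, v\<rangle>)) = qRe (herm3 n u v z)"
    unfolding herm3_def by (rule qRe_mult_commute)
  have t2: "qRe (\<langle>v, z\<rangle> * (\<langle>u, v\<rangle> * \<langle>z, u\<rangle>)) = qRe (herm3 n u v z)"
  proof -
    have "qRe (\<langle>v, z\<rangle> * (\<langle>u, v\<rangle> * \<langle>z, u\<rangle>)) = qRe (qcnj (\<langle>v, z\<rangle> * (\<langle>u, v\<rangle> * \<langle>z, u\<rangle>)))" by simp
    also have "\<dots> = qRe (\<langle>u, z\<rangle> * \<langle>v, u\<rangle> * \<langle>z, v\<rangle>)"
      using z us vs by (simp only: qcnj_mult cnj_herm)
    finally show ?thesis using t1 by (simp only: mult.assoc)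
  qed
  have "hnorm m = qRe (\<langle>u, z\<rangle> * a + \<langle>v, z\<rangle> * b)"
    using \<open>\<langle>m, m\<rangle> = \<langle>m, z\<rangle>\<close> us vs z by (simp add: m_def herm_simps)
  also have "\<dots> = (1 / ?d) * (?vv * (norm \<langle>z, u\<rangle>)\<^sup>2 + ?uu * (norm \<langle>z, v\<rangle>)\<^sup>2 - 2 * qRe (herm3 n u v z))"
    by (simp add: a_def b_def right_diff_distrib norms t1 t2 del: times_divide_eq_left)
      (simp add: algebra_simps add_divide_distrib diff_divide_distrib)
  also have "\<dots> = line_cosh_sq u v z * hnorm z"
    using z d by (simp add: line_cosh_sq_def)
  finally have hm: "hnorm m = line_cosh_sq u v z * hnorm z" .
  have zm: "z - m \<in> space" using z m by simp
  have u': "u \<noteq> 0\<^sub>v (n + 1)" "hnorm u \<le> 0" using nonposD u by auto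
  show thesis
  proof (rule that[of a b], fold m_def)
    show "hnorm m \<le> hnorm z"
      using orthogonal_semidefinite(1)[OF us u' zm o(1)] diff by simp
    show "line_cosh_sq u v z = 1 \<longrightarrow> (\<exists>s. z = u \<cdot>\<^sub>r s + v \<cdot>\<^sub>r b)"
    proof
      assume "line_cosh_sq u v z = 1"
      then have "hnorm (z - m) = 0" using diff hm by simp
      then obtain s where s: "z - m = u \<cdot>\<^sub>r s"
        using orthogonal_semidefinite(2)[OF us u' zm o(1)] by blast
      have "z = u \<cdot>\<^sub>r (a + s) + v \<cdot>\<^sub>r b"
      proof (rule eq_vecI)
        fix i assume "i < dim_vec (u \<cdot>\<^sub>r (a + s) + v \<cdot>\<^sub>r b)"
        then have i: "i < n + 1" using us vs by simp
        have "(z - m) $ i = (u \<cdot>\<^sub>r s) $ i" by (simp add: s)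
        then show "z $ i = (u \<cdot>\<^sub>r (a + s) + v \<cdot>\<^sub>r b) $ i"
          using i us vs z by (simp add: m_def algebra_simps)
      qed (use us vs z in simp)
      then show "\<exists>s. z = u \<cdot>\<^sub>r s + v \<cdot>\<^sub>r b" by blast
    qed
  qed (use o hm in auto)
qed

text \<open>
  For \<open>w\<close> in the plane of the line, \<open>\<langle>w, z\<rangle> = \<langle>w, m\<rangle>\<close> with \<open>m\<close> the projection of \<open>z\<close>. Hence \<open>cosh\<^sup>2 (\<rho>/2)\<close> of \<open>w\<close> and \<open>z\<close>
  is that of \<open>w\<close> and \<open>m\<close> times \<open>\<langle>m, m\<rangle> / \<langle>z, z\<rangle>\<close>, and the infimum is attained at \<open>w = m\<close>.
\<close>

lemma rho_line_eq:
  assumes p: "p \<in> clHH n" and q: "q \<in> clHH n" and ne: "p \<noteq> q" and s: "s \<in> HH n"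
  shows "rho_line n (qline n p q) s = 2 * arcosh (sqrt (line_cosh_sq (lift p) (lift q) (lift s)))"
    and "1 \<le> line_cosh_sq (lift p) (lift q) (lift s)"
    and "s \<notin> qline n p q \<Longrightarrow> line_cosh_sq (lift p) (lift q) (lift s) \<noteq> 1"
proof -
  let ?u = "lift p" and ?v = "lift q" and ?z = "lift s"
  have scl: "s \<in> clHH n" using s by (simp add: clHH_def)
  have z: "?z \<in> space" "hnorm ?z < 0" using clHH_lift[OF scl] s nonposD by auto
  have u: "?u \<in> nonpos" "?u \<in> space" and v: "?v \<in> nonpos" "?v \<in> space"
    using clHH_lift p q nonposD by auto
  obtain a b where ab: "\<langle>?z - (?u \<cdot>\<^sub>r a + ?v \<cdot>\<^sub>r b), ?u\<rangle> = 0" "\<langle>?z - (?u \<cdot>\<^sub>r a + ?v \<cdot>\<^sub>r b), ?v\<rangle> = 0"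
    "hnorm (?u \<cdot>\<^sub>r a + ?v \<cdot>\<^sub>r b) = line_cosh_sq ?u ?v ?z * hnorm ?z"
    "hnorm (?u \<cdot>\<^sub>r a + ?v \<cdot>\<^sub>r b) \<le> hnorm ?z"
    "line_cosh_sq ?u ?v ?z = 1 \<longrightarrow> (\<exists>s. ?z = ?u \<cdot>\<^sub>r s + ?v \<cdot>\<^sub>r b)"
    by (rule projection_onto_line[OF u(1) v(1) lifts_not_proportional[OF p q ne] z]) (rule that)
  define m where "m = ?u \<cdot>\<^sub>r a + ?v \<cdot>\<^sub>r b"
  note ab = ab[folded m_def]
  have m: "m \<in> space" "hnorm m < 0" using u v ab(4) z by (simp_all add: m_def)
  let ?L = "line_cosh_sq ?u ?v ?z"
  have L: "?L = hnorm m / hnorm ?z" using ab(3) z by simp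
  show "1 \<le> ?L" using ab(4) z by (simp add: L)
  show "?L \<noteq> 1" if "s \<notin> qline n p q"
  proof
    assume "?L = 1"
    then obtain t where "?z = ?u \<cdot>\<^sub>r t + ?v \<cdot>\<^sub>r b" using ab(5) by blast
    moreover have "?z \<noteq> 0\<^sub>v (n + 1)" using clHH_lift[OF scl] nonposD by auto
    ultimately have "proj ?z \<in> proj ` ({?u \<cdot>\<^sub>r a + ?v \<cdot>\<^sub>r b | a b. True} - {0\<^sub>v (n + 1)})"
      by blast
    then have "s \<in> qline n p q"
      unfolding qline_def using clHH_lift(2)[OF scl] scl by simp
    with that show False ..
  qed
  have dist: "rho n (proj w) s = 2 * arcosh (sqrt (cosh_sq w ?z)) \<and> 1 \<le> cosh_sq w ?z"
    if w: "w \<in> space" and h: "proj w \<in> HH n" for w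
  proof -
    obtain c where c: "c \<noteq> 0" "lift (proj w) = w \<cdot>\<^sub>r c" by (rule lift_proj)
    then have "cosh_sq (lift (proj w)) ?z = cosh_sq w ?z" using cosh_sq_rscale w z by simp
    with rho_eq[OF h s] show ?thesis by simp
  qed
  have inner: "\<langle>w, ?z\<rangle> = \<langle>w, m\<rangle>" if w: "w = ?u \<cdot>\<^sub>r e + ?v \<cdot>\<^sub>r f" for w e f
  proof -
    have "?z - m \<in> space" using z m by simp
    then have "\<langle>?u, ?z - m\<rangle> = 0" "\<langle>?v, ?z - m\<rangle> = 0"
      using cnj_herm ab(1,2) u v by (metis qcnj_0)+
    then have "\<langle>w, ?z - m\<rangle> = 0"
      using u v \<open>?z - m \<in> space\<close> unfolding w by (simp add: herm_add_left herm_rscale_left)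
    then show ?thesis using u v z m unfolding w by (simp add: herm_diff_right)
  qed
  have mHH: "proj m \<in> HH n" using m by (auto simp: HH_def V_neg_def)
  have m0: "m \<noteq> 0\<^sub>v (n + 1)" using m herm_0_left[OF m(1)] by auto
  have "cosh_sq m ?z = ?L"
  proof -
    have "norm \<langle>m, m\<rangle> = \<bar>hnorm m\<bar>" using herm_self[OF m(1)] by (metis norm_of_real)
    then show ?thesis
      using inner[OF m_def] z m by (simp add: cosh_sq_def L power2_eq_square)
  qed
  with dist[OF m(1) mHH] have rm: "rho n (proj m) s = 2 * arcosh (sqrt ?L)" by simp
  show "rho_line n (qline n p q) s = 2 * arcosh (sqrt ?L)"
    unfolding rho_line_def
  proof (rule cInf_eq_minimum)
    have "proj m \<in> qline n p q \<inter> HH n"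
      using mHH m0 unfolding qline_def clHH_def m_def by blast
    then show "2 * arcosh (sqrt ?L) \<in> (\<lambda>x. rho n x s) ` (qline n p q \<inter> HH n)"
      unfolding rm[symmetric] by blast
    fix y assume "y \<in> (\<lambda>x. rho n x s) ` (qline n p q \<inter> HH n)"
    then obtain e f w where w: "w = ?u \<cdot>\<^sub>r e + ?v \<cdot>\<^sub>r f" "proj w \<in> HH n" and y: "y = rho n (proj w) s"
      unfolding qline_def by auto
    have ws: "w \<in> space" using w u v by simp
    have wn: "hnorm w < 0"
    proof -
      obtain c where c: "c \<noteq> 0" "lift (proj w) = w \<cdot>\<^sub>r c" by (rule lift_proj)
      have "proj w \<in> clHH n" using w by (simp add: clHH_def)
      then have "(norm c)\<^sup>2 * hnorm w < 0"
        using clHH_lift(3)[of "proj w"] w(2) c ws by (simp add: hnorm_rscale)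
      then show ?thesis by (simp add: mult_less_0_iff)
    qed
    have "cosh_sq w ?z = cosh_sq w m * ?L"
      using z m wn by (simp add: cosh_sq_def L inner[OF w(1)])
    moreover have "1 \<le> cosh_sq w m" using cosh_sq_ge_1 ws wn m by blast
    ultimately have "?L \<le> cosh_sq w ?z" using \<open>1 \<le> ?L\<close>
      by (simp add: mult_le_cancel_right1)
    then have "sqrt ?L \<le> sqrt (cosh_sq w ?z)" by simp
    moreover have "1 \<le> sqrt ?L" using \<open>1 \<le> ?L\<close> by simp
    ultimately have "arcosh (sqrt ?L) \<le> arcosh (sqrt (cosh_sq w ?z))"
      by (metis arcosh_less_iff_real linorder_not_less order_trans)
    with dist[OF ws w(2)] y show "2 * arcosh (sqrt ?L) \<le> y" by simp
  qed
qed

lemma rho_line_eq_iff: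
  assumes "p \<in> clHH n" "q \<in> clHH n" "p \<noteq> q" "s \<in> HH n"
    and "p' \<in> clHH n" "q' \<in> clHH n" "p' \<noteq> q'" "s' \<in> HH n"
  shows "rho_line n (qline n p q) s = rho_line n (qline n p' q') s' \<longleftrightarrow>
    line_cosh_sq (lift p) (lift q) (lift s) = line_cosh_sq (lift p') (lift q') (lift s')"
  using rho_line_eq[OF assms(1-4)] rho_line_eq[OF assms(5-8)]
  by (metis cosh_arcosh_real mult_cancel_left real_sqrt_eq_iff real_sqrt_ge_1_iff zero_neq_numeral)

end

section \<open>Congruence of triples of points\<close>

theorem theorem1p1:
  fixes n :: nat
    and p1 p2 p3 q1 q2 q3 :: "quat vec set"
  assumes "n \<ge> 2"
    and "p1 \<in> clHH n" "p2 \<in> clHH n" "p3 \<in> clHH n"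
    and "p1 \<noteq> p2" "p1 \<noteq> p3" "p2 \<noteq> p3"
    and "q1 \<in> clHH n" "q2 \<in> clHH n" "q3 \<in> clHH n"
    and "q1 \<noteq> q2" "q1 \<noteq> q3" "q2 \<noteq> q3"
    and boundary_points_first:
      "p2 \<in> bdHH n \<Longrightarrow> p1 \<in> bdHH n" "p3 \<in> bdHH n \<Longrightarrow> p2 \<in> bdHH n"
    and noncollinear_in_case_iii:
      "p1 \<in> bdHH n \<Longrightarrow> p2 \<in> HH n \<Longrightarrow> p3 \<in> HH n \<Longrightarrow> p3 \<notin> qline n p1 p2"
  shows "(\<exists>h\<in>Sp n. act h p1 = q1 \<and> act h p2 = q2 \<and> act h p3 = q3) \<longleftrightarrow>
    (p1 \<in> bdHH n \<and> p2 \<in> bdHH n \<and> p3 \<in> bdHH n \<and>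
     q1 \<in> bdHH n \<and> q2 \<in> bdHH n \<and> q3 \<in> bdHH n \<and>
     cartan n p1 p2 p3 = cartan n q1 q2 q3)
    \<or>
    (p1 \<in> bdHH n \<and> p2 \<in> bdHH n \<and> p3 \<in> HH n \<and>
     q1 \<in> bdHH n \<and> q2 \<in> bdHH n \<and> q3 \<in> HH n \<and>
     cartan n p1 p2 p3 = cartan n q1 q2 q3 \<and>
     rho_line n (qline n p1 p2) p3 = rho_line n (qline n q1 q2) q3)
    \<or>
    (p1 \<in> bdHH n \<and> p2 \<in> HH n \<and> p3 \<in> HH n \<and>
     q1 \<in> bdHH n \<and> q2 \<in> HH n \<and> q3 \<in> HH n \<and>
     rho_line n (qline n p1 p2) p3 = rho_line n (qline n q1 q2) q3 \<and>
     rho_line n (qline n p1 p3) p2 = rho_line n (qline n q1 q3) q2 \<and>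
     rho n p2 p3 = rho n q2 q3)
    \<or>
    (p1 \<in> HH n \<and> p2 \<in> HH n \<and> p3 \<in> HH n \<and>
     q1 \<in> HH n \<and> q2 \<in> HH n \<and> q3 \<in> HH n \<and>
     cartan n p1 p2 p3 = cartan n q1 q2 q3 \<and>
     rho n p1 p2 = rho n q1 q2 \<and>
     rho n p1 p3 = rho n q1 q3 \<and>
     rho n p2 p3 = rho n q2 q3)"
    (is "?lhs \<longleftrightarrow> ?i \<or> ?ii \<or> ?iii \<or> ?iv")
proof -
  have n: "1 \<le> n" using assms(1) by simp
  note pcl = assms(2-4) and qcl = assms(8-10) and pne = assms(5-7) and qne = assms(11-13)
  note P = pcl[THEN clHH_lift(1)[OF n]] and Q = qcl[THEN clHH_lift(1)[OF n]]
  note Ps = P[THEN nonposD(1)[OF n]] and Qs = Q[THEN nonposD(1)[OF n]]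
  define N where "N p = qRe (herm n (lift p) (lift p))" for p
  define m where "m p q = norm (herm n (lift p) (lift q))" for p q
  define t where "t p q r = qRe (herm3 n (lift p) (lift q) (lift r))" for p q r
  have HH: "p \<in> HH n \<longleftrightarrow> N p < 0" and bd: "p \<in> bdHH n \<longleftrightarrow> N p = 0" and np: "N p \<le> 0"
    if "p \<in> clHH n" for p
    using clHH_lift[OF n that] nonposD(3)[OF n] by (auto simp: N_def)
  have m_sym: "m p q = m q p" if "p \<in> clHH n" "q \<in> clHH n" for p q
    unfolding m_def using that by (intro norm_herm_commute[OF n] nonposD(1)[OF n] clHH_lift(1)[OF n])
  have m_pos: "0 < m p q" if "p \<in> clHH n" "q \<in> clHH n" "p \<noteq> q" for p q
    unfolding m_def zero_less_norm_iff
    by (rule herm_nonzero(2)[OF n clHH_lift(1)[OF n that(1)] clHH_lift(1)[OF n that(2)]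
          lifts_not_proportional[OF n that]])
  have t_swap: "t p r q = t p q r" if "p \<in> clHH n" "q \<in> clHH n" "r \<in> clHH n" for p q r
  proof -
    note s = that[THEN clHH_lift(1)[OF n], THEN nonposD(1)[OF n]]
    have "qcnj (herm3 n (lift p) (lift q) (lift r)) = herm3 n (lift p) (lift r) (lift q)"
      unfolding herm3_def qcnj_mult using s by (simp only: cnj_herm[OF n] mult.assoc)
    then show ?thesis unfolding t_def by (metis qcnj.sel(1))
  qed
  have cartan: "cartan n p1 p2 p3 = cartan n q1 q2 q3 \<longleftrightarrow>
      t p1 p2 p3 / (m p2 p1 * m p3 p2 * m p1 p3) = t q1 q2 q3 / (m q2 q1 * m q3 q2 * m q1 q3)"
  proof -
    have c: "\<bar>qRe (- x) / norm x\<bar> \<le> 1" for x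
      using abs_qRe_le_norm[of x] by (cases "norm x = 0") (simp_all add: abs_divide)
    have "norm (herm3 n (lift p) (lift q) (lift r)) = m q p * m r q * m p r" for p q r
      by (simp add: herm3_def m_def norm_mult)
    moreover have "cartan n p1 p2 p3 = cartan n q1 q2 q3 \<longleftrightarrow>
        - (t p1 p2 p3 / norm (herm3 n (lift p1) (lift p2) (lift p3))) =
        - (t q1 q2 q3 / norm (herm3 n (lift q1) (lift q2) (lift q3)))"
      unfolding cartan_def Let_def arccos_eq_iff[OF conjI[OF c c]] by (simp add: t_def)
    ultimately show ?thesis by simp
  qed
  have cosh_sq: "cosh_sq n (lift p) (lift q) = (m p q)\<^sup>2 / (N p * N q)" for p q
    unfolding cosh_sq_def[OF n] m_def N_def ..
  have rho: "rho n p q = rho n p' q' \<longleftrightarrow> (m q p)\<^sup>2 / (N p * N q) = (m q' p')\<^sup>2 / (N p' * N q')"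
    if "p \<in> clHH n" "q \<in> clHH n" "p' \<in> clHH n" "q' \<in> clHH n" "N p < 0" "N q < 0" "N p' < 0" "N q' < 0"
    for p q p' q'
    using rho_eq_iff[OF n, of p q p' q'] that HH m_sym[of p q] m_sym[of p' q'] by (simp add: cosh_sq)
  have line: "line_cosh_sq n (lift p) (lift q) (lift r) =
      line_ratio (N p) (N q) (N r) (m q p) (m r q) (m p r) (t p q r)"
    if "p \<in> clHH n" "r \<in> clHH n" for p q r
    using m_sym[OF that] unfolding line_cosh_sq_def[OF n] line_ratio_def m_def N_def t_def by simp
  have rho_line: "rho_line n (qline n p q) r = rho_line n (qline n p' q') r' \<longleftrightarrow>
      line_ratio (N p) (N q) (N r) (m q p) (m r q) (m p r) (t p q r) =
      line_ratio (N p') (N q') (N r') (m q' p') (m r' q') (m p' r') (t p' q' r')"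
    if "p \<in> clHH n" "q \<in> clHH n" "p \<noteq> q" "r \<in> clHH n" "N r < 0"
      "p' \<in> clHH n" "q' \<in> clHH n" "p' \<noteq> q'" "r' \<in> clHH n" "N r' < 0" for p q r p' q' r'
    using rho_line_eq_iff[OF n, of p q r p' q' r'] that HH by (simp add: line)
  let ?sim = "moduli_similar (N p1) (N p2) (N p3) (m p2 p1) (m p3 p2) (m p1 p3) (t p1 p2 p3)
      (N q1) (N q2) (N q3) (m q2 q1) (m q3 q2) (m q1 q3) (t q1 q2 q3)"
  have lhs: "?lhs \<longleftrightarrow> ?sim"
  proof -
    have "act h p = q \<longleftrightarrow> (\<exists>a. a \<noteq> 0 \<and> h *\<^sub>v lift p = lift q \<cdot>\<^sub>r a)" if "q \<in> clHH n" for h p q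
      using act_eq_proj_iff[of h p "lift q"] clHH_lift(2)[OF n that] by simp
    note act = this[OF qcl(1)] this[OF qcl(2)] this[OF qcl(3)]
    show ?thesis
      unfolding act N_def m_def t_def
      by (rule congruent_iff_moduli_similar[OF n P Q])
        (rule lifts_not_proportional[OF n]; use pcl qcl pne qne in simp)+
  qed
  note posP = m_pos[OF pcl(2,1) pne(1)[symmetric]] m_pos[OF pcl(3,2) pne(3)[symmetric]]
    m_pos[OF pcl(1,3) pne(2)]
  note posQ = m_pos[OF qcl(2,1) qne(1)[symmetric]] m_pos[OF qcl(3,2) qne(3)[symmetric]]
    m_pos[OF qcl(1,3) qne(2)]
  note pos = posP posQ
  note types = HH[OF pcl(1)] HH[OF pcl(2)] HH[OF pcl(3)] HH[OF qcl(1)] HH[OF qcl(2)] HH[OF qcl(3)]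
    bd[OF pcl(1)] bd[OF pcl(2)] bd[OF pcl(3)] bd[OF qcl(1)] bd[OF qcl(2)] bd[OF qcl(3)]
  note nps = np[OF pcl(1)] np[OF pcl(2)] np[OF pcl(3)] np[OF qcl(1)] np[OF qcl(2)] np[OF qcl(3)]
  \<comment> \<open>Similar data have vanishing norms in the same places, and so do triples that satisfy one of
    the four conditions; hence the two triples may be assumed to be of the same type.\<close>
  let ?same = "(N p1 = 0 \<longleftrightarrow> N q1 = 0) \<and> (N p2 = 0 \<longleftrightarrow> N q2 = 0) \<and> (N p3 = 0 \<longleftrightarrow> N q3 = 0)"
  have sim_same: "?sim \<Longrightarrow> ?same" by (elim moduli_similarE) auto
  have inv_same: "?i \<or> ?ii \<or> ?iii \<or> ?iv \<Longrightarrow> ?same" unfolding types by auto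
  have equiv: "?sim \<longleftrightarrow> ?i \<or> ?ii \<or> ?iii \<or> ?iv" if same: ?same
  proof -
    consider "N p1 = 0" "N p2 = 0" "N p3 = 0" | "N p1 = 0" "N p2 = 0" "N p3 < 0"
      | "N p1 = 0" "N p2 < 0" "N p3 < 0" | "N p1 < 0" "N p2 < 0" "N p3 < 0"
      using boundary_points_first nps unfolding types by fastforce
    then show ?thesis
    proof cases
      case 1
      with same have "N q1 = 0" "N q2 = 0" "N q3 = 0" by auto
      with 1 similar_null_null_null[OF pos] show ?thesis
        unfolding types cartan by simp
    next
      case 2
      with same nps have q: "N q1 = 0" "N q2 = 0" "N q3 < 0" by auto
      have "1 \<le> line_cosh_sq n (lift p1) (lift p2) (lift p3)"
        by (rule rho_line_eq(2)[OF n pcl(1,2) pne(1)]) (use 2 types in simp)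
      then have "line_ratio 0 0 (N p3) (m p2 p1) (m p3 p2) (m p1 p3) (t p1 p2 p3) \<noteq> 0"
        unfolding line[OF pcl(1,3)] using 2 by auto
      from similar_null_null_neg[OF pos 2(3) q(3) this] 2 q show ?thesis
        unfolding types cartan
          rho_line[OF pcl(1,2) pne(1) pcl(3) 2(3) qcl(1,2) qne(1) qcl(3) q(3)]
        by simp
    next
      case 3
      with same nps have q: "N q1 = 0" "N q2 < 0" "N q3 < 0" by auto
      have "line_cosh_sq n (lift p1) (lift p2) (lift p3) \<noteq> 1"
        by (rule rho_line_eq(3)[OF n pcl(1,2) pne(1)])
          (use 3 types noncollinear_in_case_iii in simp_all)
      then have ne: "line_ratio 0 (N p2) (N p3) (m p2 p1) (m p3 p2) (m p1 p3) (t p1 p2 p3) \<noteq> 1"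
        unfolding line[OF pcl(1,3)] using 3 by simp
      have "rho_line n (qline n p1 p3) p2 = rho_line n (qline n q1 q3) q2 \<longleftrightarrow>
        line_ratio (N p1) (N p3) (N p2) (m p1 p3) (m p3 p2) (m p2 p1) (t p1 p2 p3) =
        line_ratio (N q1) (N q3) (N q2) (m q1 q3) (m q3 q2) (m q2 q1) (t q1 q2 q3)"
        using rho_line[OF pcl(1,3) pne(2) pcl(2) 3(2) qcl(1,3) qne(2) qcl(2) q(2)]
          m_sym[OF pcl(1,3)] m_sym[OF pcl(3,2)] m_sym[OF pcl(2,1)] t_swap[OF pcl]
          m_sym[OF qcl(1,3)] m_sym[OF qcl(3,2)] m_sym[OF qcl(2,1)] t_swap[OF qcl] by simp
      with similar_null_neg_neg[OF pos 3(2,3) q(2,3) ne] 3 q show ?thesis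
        unfolding types
          rho_line[OF pcl(1,2) pne(1) pcl(3) 3(3) qcl(1,2) qne(1) qcl(3) q(3)]
          rho[OF pcl(2,3) qcl(2,3) 3(2,3) q(2,3)]
        by simp
    next
      case 4
      with same nps have q: "N q1 < 0" "N q2 < 0" "N q3 < 0" by auto
      from similar_neg_neg_neg[OF pos 4 q] 4 q m_sym[OF pcl(1,3)] m_sym[OF qcl(1,3)] show ?thesis
        unfolding types cartan
          rho[OF pcl(1,2) qcl(1,2) 4(1,2) q(1,2)] rho[OF pcl(1,3) qcl(1,3) 4(1,3) q(1,3)]
          rho[OF pcl(2,3) qcl(2,3) 4(2,3) q(2,3)]
        by simp
    qed
  qed
  show ?thesis
    unfolding lhs
  proof (rule iffI)
    assume s: ?sim
    show "?i \<or> ?ii \<or> ?iii \<or> ?iv" by (rule iffD1[OF equiv[OF sim_same[OF s]] s])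
  next
    assume i: "?i \<or> ?ii \<or> ?iii \<or> ?iv"
    show ?sim by (rule iffD2[OF equiv[OF inv_same[OF i]] i])
  qed
qed

end
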